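(* Let $|\xi\rangle$ be a normalized three-qubit pure state in the GHZ class that is real, i.e. locally unitarily equivalent to a state whose coefficients in the computational basis are all real. Then there is an LOCC protocol transforming $|GHZ\rangle=\frac{1}{\sqrt2}(|000\rangle+|111\rangle)$ into $|\xi\rangle$ with probability 1 if and only if $\mathrm{Re}(\Omega(|\xi\rangle))=0$.
   Context: States are unit vectors of $\mathbb{C}^2\otimes\mathbb{C}^2\otimes\mathbb{C}^2$, shared by three parties $A,B,C$ (Alice, Bob, Charlie). Two states are in the same orbit (locally unitarily equivalent) if one is mapped to the other by $U_A\otimes U_B\otimes U_C$ with $U_A,U_B,U_C\in U(2)$. GHZ class: a state is in the GHZ class if it can be written as $(g_A\otimes g_B\otimes g_C)\frac{1}{\sqrt2}(|000\rangle+|111\rangle)$ with $g_A,g_B,g_C\in GL_2(\mathbb{C})$. Equivalently, it is locally unitarily equivalent to a normalized state of the canonical form $$\mu|000\rangle+\nu e^{i\gamma}|\varphi_A\rangle|\varphi_B\rangle|\varphi_C\rangle,\qquad |\varphi_X\rangle=\cos\delta_X|0\rangle+\sin\delta_X|1\rangle,$$ with real $\mu\ge\nu>0$, $\gamma\in[0,2\pi)$, $\delta_X\in(0,\frac{\pi}{2}]$ for $X=A,B,C$. Invariant $\Omega$: for a state in the GHZ class that is locally unitarily equivalent to the canonical form $\mu|000\rangle+\nu e^{i\gamma}|\varphi_A\rangle|\varphi_B\rangle|\varphi_C\rangle$ with $|\varphi_X\rangle=\cos\delta_X|0\rangle+\sin\delta_X|1\rangle$, $\mu\ge\nu>0$,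 $\gamma\in[0,2\pi)$, $\delta_X\in(0,\frac{\pi}{2}]$, one sets $\Omega=\mu\nu e^{i\gamma}\cos\delta_A\cos\delta_B\cos\delta_C$, i.e. the inner product of the first term with the second term of the canonical form. The canonical form is unique up to ambiguities (the sign of $\gamma$ when $\mu=\nu$; the value of $\gamma$ when some $\delta_X=\pi/2$) that do not affect $\mathrm{Re}(\Omega)$, so $\mathrm{Re}(\Omega)$ is well defined and constant on orbits. Local POVM: a finite family $\{A_i\}$ of $2\times2$ complex matrices with $\sum_i A_i^\dagger A_i=\mathbf{1}$, applied by one party; if Alice applies it to $|\chi\rangle$, outcome $i$ occurs with probability $q_i=\langle\chi|A_i^\dagger A_i\otimes\mathbf{1}\otimes\mathbf{1}|\chi\rangle$ and (if $q_i>0$) yields the state $q_i^{-1/2}(A_i\otimes\mathbf{1}\otimes\mathbf{1})|\chi\rangle$; similarly for Bob and Charlie. LOCC protocol: a finite sequence of steps, in each of which one of the parties applies a local unitary or a local POVM to her/his qubit, where the choice of each step may depend on all previous outcomes (classical communication). It transforms $|\psi\rangle$ into $|\xi\rangle$ with probability 1 if, starting from $|\psi\rangle$, every branch of outcomes occurring with nonzero probability ends in a state in the orbit of $|\xi\rangle$. *)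

theory Defs
  imports "HOL-Analysis.Analysis"
begin

text \<open>
  A vector of the three-fold tensor product has coefficients indexed by \<open>2 \<times> 2 \<times> 2\<close>. In the
  index type \<open>2\<close> the elements are 0 and 1 (with \<open>2 = 0\<close>), used as the computational basis labels.
  The norm of the finite Cartesian product is the usual Hilbert space norm.
\<close>

type_synonym qubit = "complex ^ 2"
type_synonym qubit_op = "complex ^ 2 ^ 2"
type_synonym three_qubits = "complex ^ (2 \<times> 2 \<times> 2)"
type_synonym three_qubits_op = "complex ^ (2 \<times> 2 \<times> 2) ^ (2 \<times> 2 \<times> 2)"

definition ket :: "2 \<Rightarrow> qubit" where
  "ket i = axis i 1"

definition tensor_vec :: "qubit \<Rightarrow> qubit \<Rightarrow> qubit \<Rightarrow> three_qubits" where
  "tensor_vec u v w = (\<chi> i. case i of (a, b, c) \<Rightarrow> u $ a * v $ b * w $ c)"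

definition tensor_op :: "qubit_op \<Rightarrow> qubit_op \<Rightarrow> qubit_op \<Rightarrow> three_qubits_op" where
  "tensor_op A B C =
    (\<chi> i j. case (i, j) of ((a, b, c), (a', b', c')) \<Rightarrow> A $ a $ a' * B $ b $ b' * C $ c $ c')"

definition dagger :: "qubit_op \<Rightarrow> qubit_op" where
  "dagger A = (\<chi> i j. cnj (A $ j $ i))"

definition unitary_op :: "qubit_op \<Rightarrow> bool" where
  "unitary_op U \<longleftrightarrow> dagger U ** U = mat 1 \<and> U ** dagger U = mat 1"

definition LU_equivalent :: "three_qubits \<Rightarrow> three_qubits \<Rightarrow> bool" where
  "LU_equivalent \<psi> \<phi> \<longleftrightarrow>
    (\<exists>U V W. unitary_op U \<and> unitary_op V \<and> unitary_op W \<and> \<phi> = tensor_op U V W *v \<psi>)"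

definition GHZ :: three_qubits where
  "GHZ = (1 / sqrt 2) *\<^sub>R
    (tensor_vec (ket 0) (ket 0) (ket 0) + tensor_vec (ket 1) (ket 1) (ket 1))"

definition in_GHZ_class :: "three_qubits \<Rightarrow> bool" where
  "in_GHZ_class \<psi> \<longleftrightarrow>
    (\<exists>gA gB gC. invertible gA \<and> invertible gB \<and> invertible gC \<and> \<psi> = tensor_op gA gB gC *v GHZ)"

definition real_state :: "three_qubits \<Rightarrow> bool" where
  "real_state \<psi> \<longleftrightarrow> (\<exists>\<phi>. LU_equivalent \<psi> \<phi> \<and> (\<forall>i. \<phi> $ i \<in> \<real>))"

definition tilted_ket :: "real \<Rightarrow> qubit" where
  "tilted_ket \<delta> = complex_of_real (cos \<delta>) *s ket 0 + complex_of_real (sin \<delta>) *s ket 1"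

definition canonical_form ::
    "real \<Rightarrow> real \<Rightarrow> real \<Rightarrow> real \<Rightarrow> real \<Rightarrow> real \<Rightarrow> three_qubits" where
  "canonical_form \<mu> \<nu> \<gamma> \<delta>A \<delta>B \<delta>C =
    complex_of_real \<mu> *s tensor_vec (ket 0) (ket 0) (ket 0)
    + (complex_of_real \<nu> * cis \<gamma>) *s tensor_vec (tilted_ket \<delta>A) (tilted_ket \<delta>B) (tilted_ket \<delta>C)"

definition canonical_params ::
    "real \<Rightarrow> real \<Rightarrow> real \<Rightarrow> real \<Rightarrow> real \<Rightarrow> real \<Rightarrow> bool" where
  "canonical_params \<mu> \<nu> \<gamma> \<delta>A \<delta>B \<delta>C \<longleftrightarrow>
    \<nu> > 0 \<and> \<mu> \<ge> \<nu> \<and> \<gamma> \<in> {0..<2 * pi} \<and>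
    \<delta>A \<in> {0<..pi / 2} \<and> \<delta>B \<in> {0<..pi / 2} \<and> \<delta>C \<in> {0<..pi / 2}"

definition is_Omega :: "three_qubits \<Rightarrow> complex \<Rightarrow> bool" where
  "is_Omega \<psi> \<omega> \<longleftrightarrow>
    (\<exists>\<mu> \<nu> \<gamma> \<delta>A \<delta>B \<delta>C. canonical_params \<mu> \<nu> \<gamma> \<delta>A \<delta>B \<delta>C \<and>
      LU_equivalent \<psi> (canonical_form \<mu> \<nu> \<gamma> \<delta>A \<delta>B \<delta>C) \<and>
      \<omega> = complex_of_real (\<mu> * \<nu>) * cis \<gamma> * complex_of_real (cos \<delta>A * cos \<delta>B * cos \<delta>C))"

text \<open>
  For a state in the GHZ class a canonical form exists, and the resulting \<open>\<omega>\<close> is unique up to complex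
  conjugation (the sign of \<open>\<gamma>\<close> when \<open>\<mu> = \<nu>\<close>). Hence \<open>SOME\<close> rather than \<open>THE\<close>; only
  the real part is canonical. Outside the GHZ class the value is unspecified.
\<close>

definition Omega :: "three_qubits \<Rightarrow> complex" where
  "Omega \<psi> = (SOME \<omega>. is_Omega \<psi> \<omega>)"

datatype party = Alice | Bob | Charlie

fun on_party :: "party \<Rightarrow> qubit_op \<Rightarrow> three_qubits_op" where
  "on_party Alice A = tensor_op A (mat 1) (mat 1)"
| "on_party Bob A = tensor_op (mat 1) A (mat 1)"
| "on_party Charlie A = tensor_op (mat 1) (mat 1) A"

text \<open>
  The inner product of the library is the real part of the Hermitian one, which is already real
  for the expectation value of \<open>dagger A ** A\<close>.
\<close>

definition outcome_prob :: "party \<Rightarrow> qubit_op \<Rightarrow> three_qubits \<Rightarrow> real" where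
  "outcome_prob X A \<psi> = inner \<psi> (on_party X (dagger A ** A) *v \<psi>)"

definition post_state :: "party \<Rightarrow> qubit_op \<Rightarrow> three_qubits \<Rightarrow> three_qubits" where
  "post_state X A \<psi> = (1 / sqrt (outcome_prob X A \<psi>)) *\<^sub>R (on_party X A *v \<psi>)"

text \<open>
  A protocol is a finite tree, so that every step may depend on all earlier outcomes. The list in
  a measurement node pairs each POVM element with the continuation after that outcome; equal
  elements at different positions are different outcomes.
\<close>

datatype protocol =
    Finish
  | Rotate party qubit_op protocol
  | Measure party "(qubit_op \<times> protocol) list"

definition is_POVM :: "qubit_op list \<Rightarrow> bool" where
  "is_POVM As \<longleftrightarrow> (\<Sum>A\<leftarrow>As. dagger A ** A) = mat 1"

inductive valid_protocol :: "protocol \<Rightarrow> bool" where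
  "valid_protocol Finish"
| "unitary_op U \<Longrightarrow> valid_protocol p \<Longrightarrow> valid_protocol (Rotate X U p)"
| "is_POVM (map fst bs) \<Longrightarrow> (\<And>A p. (A, p) \<in> set bs \<Longrightarrow> valid_protocol p)
    \<Longrightarrow> valid_protocol (Measure X bs)"

text \<open>
  \<open>can_end p \<psi> \<phi>\<close>: some branch of \<open>p\<close> started in \<open>\<psi>\<close> has nonzero probability and ends in \<open>\<phi>\<close>.
\<close>

inductive can_end :: "protocol \<Rightarrow> three_qubits \<Rightarrow> three_qubits \<Rightarrow> bool" where
  "can_end Finish \<psi> \<psi>"
| "can_end p (on_party X U *v \<psi>) \<phi> \<Longrightarrow> can_end (Rotate X U p) \<psi> \<phi>"
| "(A, p) \<in> set bs \<Longrightarrow> outcome_prob X A \<psi> > 0 \<Longrightarrow> can_end p (post_state X A \<psi>) \<phi>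
    \<Longrightarrow> can_end (Measure X bs) \<psi> \<phi>"

definition LOCC_transforms :: "three_qubits \<Rightarrow> three_qubits \<Rightarrow> bool" where
  "LOCC_transforms \<psi> \<xi> \<longleftrightarrow>
    (\<exists>p. valid_protocol p \<and> (\<forall>\<phi>. can_end p \<psi> \<phi> \<longrightarrow> LU_equivalent \<xi> \<phi>))"

end

theory Submission
  imports Defs
begin

text \<open>
  A state of the GHZ class is a sum of two product vectors in exactly one way, up to order, so
  \<open>Re \<Omega>\<close> is the real inner product of these two terms. A local measurement acts on each term
  separately, hence conserves this inner product on average. It vanishes for the GHZ state, so it
  vanishes for any state reached with certainty.

  Conversely, let \<open>Re \<Omega> = 0\<close>. Reality of the state forces either \<open>\<Omega> = 0\<close>, so that some local
  factors are orthogonal, or \<open>\<mu> = \<nu>\<close> and \<open>e\<^sup>i\<^sup>\<gamma> = \<plusminus>\<i>\<close>. Two parties tilt their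
  second factors, each correctable by a sign flip of a party whose factors are still orthogonal. The
  third party, whose factors are orthogonal in the target if \<open>\<Omega> = 0\<close>, then either adjusts the
  weights \<open>\<mu>, \<nu>\<close> or tilts as well. The two possible results
  differ by the exchange of the two product vectors, which is a local unitary.
\<close>

section \<open>Product vectors and local operators\<close>

text \<open>The library enumerates this index type as 1 and 2; the identity carries its facts over
  to the basis labels 0 and 1.\<close>

lemma two_eq_zero: "(2::2) = 0"
  using exhaust_2[of 0] by auto

lemma sum_UNIV_2: "(\<Sum>i\<in>UNIV. f i) = f (0::2) + (f 1 :: 'a::comm_monoid_add)"
  using sum_2[of f] by (simp add: add.commute two_eq_zero)

lemma all_2: "(\<forall>i::2. P i) \<longleftrightarrow> P 0 \<and> P 1"
  using forall_2[of P] by (auto simp: two_eq_zero)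

lemma sum_UNIV_prod:
  "(\<Sum>i\<in>UNIV. f i) = (\<Sum>a\<in>UNIV. \<Sum>b\<in>UNIV. (f (a, b) :: 'a::comm_monoid_add))"
  by (simp add: sum.cartesian_product flip: UNIV_Times_UNIV)

lemma all_party: "(\<forall>X. P X) \<longleftrightarrow> P Alice \<and> P Bob \<and> P Charlie"
  by (metis party.exhaust)

lemma UNIV_party: "UNIV = {Alice, Bob, Charlie}"
  using party.exhaust by auto

text \<open>Indexing the factors by \<open>party\<close> turns an action of one party into a
  function update and avoids threefold case distinctions.\<close>

definition tri :: "(party \<Rightarrow> qubit) \<Rightarrow> three_qubits" where
  "tri f = tensor_vec (f Alice) (f Bob) (f Charlie)"

definition local_op :: "(party \<Rightarrow> qubit_op) \<Rightarrow> three_qubits_op" where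
  "local_op G = tensor_op (G Alice) (G Bob) (G Charlie)"

lemma tri_nth [simp]: "tri f $ (a, b, c) = f Alice $ a * f Bob $ b * f Charlie $ c"
  by (simp add: tri_def tensor_vec_def)

lemma local_op_nth [simp]:
  "local_op G $ (a, b, c) $ (a', b', c') = G Alice $ a $ a' * G Bob $ b $ b' * G Charlie $ c $ c'"
  by (simp add: local_op_def tensor_op_def)

lemma on_party_eq: "on_party X A = local_op ((\<lambda>_. mat 1)(X := A))"
  by (cases X) (simp_all add: local_op_def)

lemma local_op_tri: "local_op G *v tri f = tri (\<lambda>X. G X *v f X)"
  by (simp add: vec_eq_iff matrix_vector_mult_def sum_UNIV_prod sum_product,
      simp add: sum_distrib_left sum_distrib_right ac_simps)
    (intro allI sum.cong refl sum.swap)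

lemma on_party_tri: "on_party X A *v tri f = tri (f(X := A *v f X))"
  unfolding on_party_eq local_op_tri by (rule arg_cong[where f = tri]) auto

lemma local_op_mult: "local_op G ** local_op H = local_op (\<lambda>X. G X ** H X)"
  by (simp add: vec_eq_iff matrix_matrix_mult_def sum_UNIV_prod sum_product,
      simp add: sum_distrib_left sum_distrib_right ac_simps)
    (intro allI sum.cong refl sum.swap)

lemma local_op_one: "local_op (\<lambda>_. mat 1) = mat 1"
  by (auto simp: vec_eq_iff mat_def)

lemma local_op_apply: "local_op G *v (local_op H *v \<psi>) = local_op (\<lambda>X. G X ** H X) *v \<psi>"
  by (simp add: matrix_vector_mul_assoc local_op_mult)

text \<open>By multilinearity a coefficient can be absorbed into the factor of any chosen party, so
  a state with weights still has the form \<open>tri f + tri g\<close>.\<close>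

lemma scale_tri: "z *s tri f = tri (f(X := z *s f X))"
  by (cases X) (simp_all add: vec_eq_iff)

lemma scaleR_eq_smult: "r *\<^sub>R (v :: complex ^ 'n) = complex_of_real r *s v"
  by (simp only: vec_eq_iff vector_scaleR_component) (simp add: scaleR_conv_of_real)

lemma norm_smult: "norm (z *s (v :: complex ^ 'n)) = cmod z * norm v"
  by (simp add: norm_vec_def L2_set_def norm_mult power_mult_distrib real_sqrt_mult
      flip: sum_distrib_left)

lemma mult_scale: "(M :: complex ^ 'n ^ 'm) *v (z *s v) = z *s (M *v v)"
  by (simp add: vec_eq_iff matrix_vector_mult_def sum_distrib_left algebra_simps)

lemma inner_local_op: "inner (local_op G *v \<psi>) \<phi> = inner \<psi> (local_op (\<lambda>X. dagger (G X)) *v \<phi>)"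
proof -
  have "inner (local_op G *v \<psi>) \<phi> = (\<Sum>i\<in>UNIV. \<Sum>j\<in>UNIV. inner (local_op G $ i $ j * \<psi> $ j) (\<phi> $ i))"
    by (simp add: inner_vec_def matrix_vector_mult_def inner_sum_left)
  also have "\<dots> = (\<Sum>j\<in>UNIV. \<Sum>i\<in>UNIV. inner (local_op G $ i $ j * \<psi> $ j) (\<phi> $ i))"
    by (rule sum.swap)
  also have "\<dots> = (\<Sum>j\<in>UNIV. \<Sum>i\<in>UNIV. inner (\<psi> $ j) (local_op (\<lambda>X. dagger (G X)) $ j $ i * \<phi> $ i))"
  proof (intro sum.cong refl)
    fix i j :: "2 \<times> 2 \<times> 2"
    have "local_op (\<lambda>X. dagger (G X)) $ j $ i = cnj (local_op G $ i $ j)"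
      by (cases i; cases j) (simp add: dagger_def)
    then show "inner (local_op G $ i $ j * \<psi> $ j) (\<phi> $ i)
        = inner (\<psi> $ j) (local_op (\<lambda>X. dagger (G X)) $ j $ i * \<phi> $ i)"
      by (simp add: inner_complex_def algebra_simps)
  qed
  also have "\<dots> = inner \<psi> (local_op (\<lambda>X. dagger (G X)) *v \<phi>)"
    by (simp add: inner_vec_def matrix_vector_mult_def inner_sum_right)
  finally show ?thesis .
qed

lemma dagger_one [simp]: "dagger (mat 1) = mat 1"
  by (auto simp: dagger_def mat_def vec_eq_iff)

lemma inner_on_party: "inner (on_party X A *v \<psi>) \<phi> = inner \<psi> (on_party X (dagger A) *v \<phi>)"
  unfolding on_party_eq inner_local_op
  by (rule arg_cong[where f = "\<lambda>G. inner \<psi> (local_op G *v \<phi>)"]) auto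

lemma on_party_apply: "on_party X A *v (on_party X B *v \<psi>) = on_party X (A ** B) *v \<psi>"
  unfolding on_party_eq local_op_apply
  by (rule arg_cong[where f = "\<lambda>G. local_op G *v \<psi>"]) auto

lemma on_party_add: "on_party X (A + B) *v \<psi> = on_party X A *v \<psi> + on_party X B *v \<psi>"
proof -
  have "on_party X (A + B) = on_party X A + on_party X B"
    by (cases X) (auto simp: vec_eq_iff tensor_op_def algebra_simps)
  then show ?thesis
    by (simp add: matrix_vector_mult_add_rdistrib)
qed

lemma on_party_zero: "on_party X 0 *v \<psi> = 0"
proof -
  have "on_party X 0 = 0"
    by (cases X) (auto simp: vec_eq_iff tensor_op_def)
  then show ?thesis
    by simp
qed

lemma on_party_one: "on_party X (mat 1) *v \<psi> = \<psi>"
  by (simp add: on_party_eq local_op_one fun_upd_idem)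

section \<open>Unitary operators and local unitary equivalence\<close>

lemma unitary_one [simp]: "unitary_op (mat 1)"
  by (simp add: unitary_op_def)

lemma dagger_mult: "dagger (A ** B) = dagger B ** dagger A"
  by (simp add: vec_eq_iff dagger_def matrix_matrix_mult_def mult.commute)

lemma dagger_dagger [simp]: "dagger (dagger A) = A"
  by (simp add: dagger_def vec_eq_iff)

lemma unitary_mult: "unitary_op U \<Longrightarrow> unitary_op V \<Longrightarrow> unitary_op (U ** V)"
  unfolding unitary_op_def dagger_mult by (metis matrix_mul_assoc matrix_mul_rid)

lemma unitary_dagger: "unitary_op U \<Longrightarrow> unitary_op (dagger U)"
  by (simp add: unitary_op_def)

lemma LU_equivalent_iff:
  "LU_equivalent \<psi> \<phi> \<longleftrightarrow> (\<exists>U. (\<forall>X. unitary_op (U X)) \<and> \<phi> = local_op U *v \<psi>)"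
proof
  assume "LU_equivalent \<psi> \<phi>"
  then obtain U V W where *: "unitary_op U" "unitary_op V" "unitary_op W" "\<phi> = tensor_op U V W *v \<psi>"
    unfolding LU_equivalent_def by blast
  then show "\<exists>U. (\<forall>X. unitary_op (U X)) \<and> \<phi> = local_op U *v \<psi>"
    by (intro exI[of _ "case_party U V W"]) (auto simp: all_party local_op_def)
qed (auto simp: LU_equivalent_def local_op_def)

lemma LU_equivalentI: "(\<And>X. unitary_op (U X)) \<Longrightarrow> local_op U *v \<psi> = \<phi> \<Longrightarrow> LU_equivalent \<psi> \<phi>"
  unfolding LU_equivalent_iff by blast

lemma LU_equivalent_trans:
  assumes "LU_equivalent \<psi> \<phi>" "LU_equivalent \<phi> \<theta>"
  shows "LU_equivalent \<psi> \<theta>"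
proof -
  obtain U V where "\<And>X. unitary_op (U X)" "\<phi> = local_op U *v \<psi>"
    and "\<And>X. unitary_op (V X)" "\<theta> = local_op V *v \<phi>"
    using assms unfolding LU_equivalent_iff by blast
  then show ?thesis
    by (intro LU_equivalentI[of "\<lambda>X. V X ** U X"]) (simp_all add: unitary_mult local_op_apply)
qed

lemma unitary_cancel:
  assumes "\<And>X. unitary_op (U X)"
  shows "local_op (\<lambda>X. dagger (U X)) *v (local_op U *v \<psi>) = \<psi>"
  using assms by (simp add: local_op_apply unitary_op_def local_op_one)

lemma LU_equivalent_sym:
  assumes "LU_equivalent \<psi> \<phi>"
  shows "LU_equivalent \<phi> \<psi>"
proof -
  obtain U where U: "\<And>X. unitary_op (U X)" "\<phi> = local_op U *v \<psi>"
    using assms unfolding LU_equivalent_iff by blast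
  show ?thesis
    by (rule LU_equivalentI[of "\<lambda>X. dagger (U X)"]) (simp_all add: U unitary_dagger unitary_cancel)
qed

lemma inner_unitary:
  "(\<And>X. unitary_op (U X)) \<Longrightarrow> inner (local_op U *v \<psi>) (local_op U *v \<phi>) = inner \<psi> \<phi>"
  by (simp add: inner_local_op unitary_cancel)

lemma norm_unitary: "(\<And>X. unitary_op (U X)) \<Longrightarrow> norm (local_op U *v \<psi>) = norm \<psi>"
  by (simp add: norm_eq_sqrt_inner inner_unitary)

lemma LU_equivalent_norm: "LU_equivalent \<psi> \<phi> \<Longrightarrow> norm \<phi> = norm \<psi>"
  unfolding LU_equivalent_iff using norm_unitary by blast

text \<open>The Hermitian inner product of qubits. Its complex value matters: the real part may be
  taken only after multiplying over the parties.\<close>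

definition cinner :: "qubit \<Rightarrow> qubit \<Rightarrow> complex" where
  "cinner u v = cnj (u $ 0) * v $ 0 + cnj (u $ 1) * v $ 1"

lemma inner_tri: "inner (tri f) (tri g) = Re (\<Prod>X\<in>UNIV. cinner (f X) (g X))"
proof -
  have *: "inner a b = Re (cnj a * b)" for a b :: complex
    by (simp add: inner_complex_def)
  show ?thesis
    unfolding inner_vec_def * Re_sum[symmetric]
    by (intro arg_cong[where f = Re])
      (simp add: sum_UNIV_prod sum_UNIV_2 UNIV_party cinner_def algebra_simps)
qed

section \<open>Uniqueness of the decomposition into two product vectors\<close>

text \<open>Nonzero exactly when the two vectors are linearly independent. Nonvanishing for every
  party is the working form of membership in the GHZ class.\<close>

definition det2 :: "qubit \<Rightarrow> qubit \<Rightarrow> complex" where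
  "det2 u v = u $ 0 * v $ 1 - u $ 1 * v $ 0"

lemma det2_mult: "det2 (G *v u) (G *v v) = det G * det2 u v"
proof -
  have "det G = G $ 1 $ 1 * G $ 0 $ 0 - G $ 1 $ 0 * G $ 0 $ 1"
    using det_2[of G] by (simp add: two_eq_zero)
  show ?thesis
    unfolding \<open>det G = _\<close> by (simp add: det2_def matrix_vector_mult_def sum_UNIV_2 algebra_simps)
qed

lemma det2_scale: "det2 (z *s u) (w *s v) = z * w * det2 u v"
  by (simp add: det2_def algebra_simps)

definition slice_det :: "three_qubits \<Rightarrow> 2 \<Rightarrow> complex" where
  "slice_det \<psi> a = \<psi> $ (a, 0, 0) * \<psi> $ (a, 1, 1) - \<psi> $ (a, 0, 1) * \<psi> $ (a, 1, 0)"

text \<open>The coefficient of \<open>x * y\<close> in the determinant of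
  \<open>x * S0 + y * S1\<close>, where \<open>S0\<close> and \<open>S1\<close> are the slices at
  Alice's index 0 and 1.\<close>

definition slice_mixed :: "three_qubits \<Rightarrow> complex" where
  "slice_mixed \<psi> = \<psi> $ (0, 0, 0) * \<psi> $ (1, 1, 1) + \<psi> $ (1, 0, 0) * \<psi> $ (0, 1, 1)
    - \<psi> $ (0, 0, 1) * \<psi> $ (1, 1, 0) - \<psi> $ (1, 0, 1) * \<psi> $ (0, 1, 0)"

text \<open>Cayley's hyperdeterminant, as the discriminant of the determinant of the pencil of slices.\<close>

definition hyperdet :: "three_qubits \<Rightarrow> complex" where
  "hyperdet \<psi> = (slice_mixed \<psi>)\<^sup>2 - 4 * slice_det \<psi> 0 * slice_det \<psi> 1"

text \<open>Each slice combines the same two rank-one matrices, so the determinant of the pencil is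
  \<open>D\<close> times a product of two linear forms, whose discriminant is a square.\<close>

lemma hyperdet_tri_add: "hyperdet (tri f + tri g) = (\<Prod>X\<in>UNIV. det2 (f X) (g X))\<^sup>2"
proof -
  define D where "D = det2 (f Bob) (g Bob) * det2 (f Charlie) (g Charlie)"
  have 1: "slice_det (tri f + tri g) a = f Alice $ a * g Alice $ a * D" for a
    by (simp add: slice_det_def D_def det2_def algebra_simps)
  have 2: "slice_mixed (tri f + tri g) = (f Alice $ 0 * g Alice $ 1 + f Alice $ 1 * g Alice $ 0) * D"
    by (simp add: slice_mixed_def D_def det2_def algebra_simps)
  have 3: "(\<Prod>X\<in>UNIV. det2 (f X) (g X)) = det2 (f Alice) (g Alice) * D"
    by (simp add: UNIV_party D_def)
  show ?thesis
    unfolding hyperdet_def 1 2 3 by (simp add: det2_def power2_eq_square algebra_simps)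
qed

text \<open>The hyperdeterminant depends on the vector alone, so independence at all parties passes
  from one decomposition to any other.\<close>

lemma det2_nonzero_transfer:
  assumes "tri f + tri g = tri f' + tri g'" "\<And>X. det2 (f X) (g X) \<noteq> 0"
  shows "det2 (f' X) (g' X) \<noteq> 0"
proof -
  have "(\<Prod>X\<in>UNIV. det2 (f' X) (g' X))\<^sup>2 \<noteq> 0"
    using hyperdet_tri_add[of f g] hyperdet_tri_add[of f' g'] assms by (simp add: UNIV_party)
  then show ?thesis
    by (cases X) (auto simp: UNIV_party)
qed

lemma ket_nth [simp]: "ket 0 $ 0 = 1" "ket 0 $ 1 = 0" "ket 1 $ 0 = 0" "ket 1 $ 1 = 1"
  by (simp_all add: ket_def axis_def)

text \<open>Elimination along Alice's index leaves rank-one matrices for Bob and Charlie that are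
  diagonal, and such a matrix has only one nonzero entry.\<close>

lemma product_decomposition_unique_ket:
  assumes eq: "tri (\<lambda>_. ket 0) + tri (\<lambda>_. ket 1) = tri f + tri g"
  shows "(tri f = tri (\<lambda>_. ket 0) \<and> tri g = tri (\<lambda>_. ket 1))
    \<or> (tri f = tri (\<lambda>_. ket 1) \<and> tri g = tri (\<lambda>_. ket 0))"
proof -
  have nz: "det2 (f Alice) (g Alice) \<noteq> 0"
    by (rule det2_nonzero_transfer[OF eq]) (simp add: det2_def)
  define d d' e e' h h' where "d = (\<lambda>i. f Alice $ i)" and "d' = (\<lambda>i. g Alice $ i)"
    and "e = (\<lambda>i. f Bob $ i)" and "e' = (\<lambda>i. g Bob $ i)"
    and "h = (\<lambda>i. f Charlie $ i)" and "h' = (\<lambda>i. g Charlie $ i)"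
  note defs = this
  have E: "d a * e b * h c + d' a * e' b * h' c = ket 0 $ a * ket 0 $ b * ket 0 $ c
      + ket 1 $ a * ket 1 $ b * ket 1 $ c" for a b c
    using arg_cong[OF eq, of "\<lambda>v. v $ (a, b, c)"] by (simp add: defs)
  define D where "D = d 0 * d' 1 - d 1 * d' 0"
  have D: "D \<noteq> 0"
    using nz by (simp add: D_def defs det2_def)
  \<comment> \<open>Cramer's rule for the two equations at Alice's index 0 and 1; here the term of
    \<open>g\<close> is eliminated, in \<open>R\<close> that of \<open>f\<close>.\<close>
  have L: "D * (e b * h c) = d' 1 * (ket 0 $ b * ket 0 $ c) - d' 0 * (ket 1 $ b * ket 1 $ c)" for b c
    using E[of 0 b c] E[of 1 b c] unfolding D_def by simp algebra
  have R: "D * (e' b * h' c) = d 0 * (ket 1 $ b * ket 1 $ c) - d 1 * (ket 0 $ b * ket 0 $ c)" for b c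
    using E[of 0 b c] E[of 1 b c] unfolding D_def by simp algebra
  have l: "D * (e 0 * h 0) = d' 1" "D * (e 1 * h 1) = - d' 0" "e 0 * h 1 = 0" "e 1 * h 0 = 0"
    using L[of 0 0] L[of 1 1] L[of 0 1] L[of 1 0] D by auto
  have r: "D * (e' 0 * h' 0) = - d 1" "D * (e' 1 * h' 1) = d 0" "e' 0 * h' 1 = 0" "e' 1 * h' 0 = 0"
    using R[of 0 0] R[of 1 1] R[of 0 1] R[of 1 0] D by auto
  \<comment> \<open>Either all factors of \<open>f\<close> are multiples of \<open>ket 0\<close> and
    those of \<open>g\<close> of \<open>ket 1\<close>, or the other way round. The entries at 000
    and 111 then fix the scalars.\<close>
  have "(d' 0 = 0 \<and> e 1 = 0 \<and> h 1 = 0 \<and> d 1 = 0 \<and> e' 0 = 0 \<and> h' 0 = 0)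
      \<or> (d' 1 = 0 \<and> e 0 = 0 \<and> h 0 = 0 \<and> d 0 = 0 \<and> e' 1 = 0 \<and> h' 1 = 0)"
  proof (cases "d' 0 = 0")
    case True
    then have "d 0 \<noteq> 0" "d' 1 \<noteq> 0"
      using D by (auto simp: D_def)
    then have "e 0 \<noteq> 0" "h 0 \<noteq> 0" "e' 1 \<noteq> 0" "h' 1 \<noteq> 0"
      using l r by auto
    then show ?thesis
      using l r True by auto
  next
    case False
    then have "e 1 \<noteq> 0" "h 1 \<noteq> 0"
      using l by auto
    then have z: "e 0 = 0" "h 0 = 0" "d' 1 = 0"
      using l by auto
    then have "d 1 \<noteq> 0"
      using D by (auto simp: D_def)
    then have "e' 0 \<noteq> 0" "h' 0 \<noteq> 0"
      using r by auto
    then show ?thesis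
      using z r by auto
  qed
  then show ?thesis
    using E[of 0 0 0] E[of 1 1 1] by (auto simp: vec_eq_iff all_2 defs)
qed

text \<open>Independence makes the matrix with columns \<open>f X\<close> and \<open>g X\<close>
  invertible; its inverse at every party reduces the claim to basis vectors.\<close>

lemma product_decomposition_unique:
  assumes eq: "tri f + tri g = tri f' + tri g'" and nz: "\<And>X. det2 (f X) (g X) \<noteq> 0"
  shows "(tri f' = tri f \<and> tri g' = tri g) \<or> (tri f' = tri g \<and> tri g' = tri f)"
proof -
  define G :: "party \<Rightarrow> qubit_op" where "G X = (\<chi> i j. if j = 0 then f X $ i else g X $ i)" for X
  have Gk: "G X *v ket 0 = f X" "G X *v ket 1 = g X" for X
    by (simp_all add: G_def vec_eq_iff matrix_vector_mult_def sum_UNIV_2)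
  have "det (G X) \<noteq> 0" for X
    using det2_mult[of "G X" "ket 0" "ket 1"] nz[of X] by (auto simp: Gk)
  then have "\<forall>X. \<exists>H. H ** G X = mat 1 \<and> G X ** H = mat 1"
    unfolding invertible_det_nz[symmetric] invertible_def by blast
  then obtain H where H: "\<And>X. H X ** G X = mat 1" "\<And>X. G X ** H X = mat 1"
    by metis
  have c1: "local_op H *v (local_op G *v \<psi>) = \<psi>" and c2: "local_op G *v (local_op H *v \<psi>) = \<psi>" for \<psi>
    by (simp_all add: local_op_apply H local_op_one)
  have fg: "tri f = local_op G *v tri (\<lambda>_. ket 0)" "tri g = local_op G *v tri (\<lambda>_. ket 1)"
    by (simp_all add: local_op_tri Gk)
  have "local_op H *v (tri f + tri g) = local_op H *v (tri f' + tri g')"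
    by (simp only: eq)
  then have "tri (\<lambda>_. ket 0) + tri (\<lambda>_. ket 1) = tri (\<lambda>X. H X *v f' X) + tri (\<lambda>X. H X *v g' X)"
    by (simp only: fg matrix_vector_right_distrib c1 local_op_tri[of H])
  from product_decomposition_unique_ket[OF this] show ?thesis
    unfolding fg local_op_tri[symmetric] by (metis c2)
qed

text \<open>A possible exchange of the two terms is harmless because the real inner product is
  symmetric; the Hermitian one would be conjugated.\<close>

lemma decomposition_inner_unique:
  assumes "tri f + tri g = tri f' + tri g'" "\<And>X. det2 (f X) (g X) \<noteq> 0"
  shows "inner (tri f') (tri g') = inner (tri f) (tri g)"
  using product_decomposition_unique[OF assms] by (auto simp: inner_commute)

lemma unitary_det_nonzero: "unitary_op U \<Longrightarrow> det U \<noteq> 0"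
  unfolding unitary_op_def invertible_det_nz[symmetric] invertible_def by blast

section \<open>Local measurements conserve the inner product of the two terms on average\<close>

lemma outcome_prob_eq: "outcome_prob X A \<psi> = (norm (on_party X A *v \<psi>))\<^sup>2"
  by (simp add: outcome_prob_def power2_norm_eq_inner inner_on_party on_party_apply)

text \<open>The completeness relation in polarized form: with equal arguments it says that the
  probabilities sum to 1, with the two product terms it is the conservation law.\<close>

lemma POVM_inner:
  assumes "is_POVM As"
  shows "(\<Sum>A\<leftarrow>As. inner (on_party X A *v \<psi>) (on_party X A *v \<phi>)) = inner \<psi> \<phi>"
proof -
  have "(\<Sum>A\<leftarrow>As. inner (on_party X A *v \<psi>) (on_party X A *v \<phi>))
      = inner \<psi> (on_party X (\<Sum>A\<leftarrow>As. dagger A ** A) *v \<phi>)" for As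
    by (induction As)
      (simp_all add: on_party_zero on_party_add inner_add_right inner_on_party on_party_apply)
  then show ?thesis
    using assms by (simp add: is_POVM_def on_party_one)
qed

text \<open>Fixing the indices of the other parties gives two equations in the two unknown products
  of their entries, with determinant \<open>det2 (f Y) (g Y)\<close>.\<close>

lemma tri_add_eq_zero:
  assumes sum: "tri f + tri g = 0" and Y: "det2 (f Y) (g Y) \<noteq> 0"
  shows "tri f = 0"
proof -
  have lin: "P = 0" if "x * P + x' * Q = 0" "y * P + y' * Q = 0" "x * y' - y * x' \<noteq> 0"
    for x x' y y' P Q :: complex
  proof -
    have "(x * y' - y * x') * P = 0"
      using that(1,2) by algebra
    then show ?thesis
      using that(3) by simp
  qed
  have E: "f Alice $ a * f Bob $ b * f Charlie $ c + g Alice $ a * g Bob $ b * g Charlie $ c = 0" for a b c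
    using arg_cong[OF sum, of "\<lambda>v. v $ (a, b, c)"] by simp
  have "f Alice $ a * f Bob $ b * f Charlie $ c = 0" for a b c
  proof (cases Y)
    case Alice
    have "f Bob $ b * f Charlie $ c = 0"
      by (rule lin[of "f Alice $ 0" _ "g Alice $ 0" "g Bob $ b * g Charlie $ c" "f Alice $ 1" "g Alice $ 1"])
        (use E[of 0 b c] E[of 1 b c] Y Alice in \<open>simp_all add: det2_def mult.assoc\<close>)
    then show ?thesis
      by auto
  next
    case Bob
    have "f Alice $ a * f Charlie $ c = 0"
      by (rule lin[of "f Bob $ 0" _ "g Bob $ 0" "g Alice $ a * g Charlie $ c" "f Bob $ 1" "g Bob $ 1"])
        (use E[of a 0 c] E[of a 1 c] Y Bob in \<open>simp_all add: det2_def ac_simps\<close>)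
    then show ?thesis
      by auto
  next
    case Charlie
    have "f Alice $ a * f Bob $ b = 0"
      by (rule lin[of "f Charlie $ 0" _ "g Charlie $ 0" "g Alice $ a * g Bob $ b" "f Charlie $ 1" "g Charlie $ 1"])
        (use E[of a b 0] E[of a b 1] Y Charlie in \<open>simp_all add: det2_def ac_simps\<close>)
    then show ?thesis
      by auto
  qed
  then show ?thesis
    by (simp add: vec_eq_iff)
qed

text \<open>Induction from the leaves to the root: the inner product at a node is the average of
  those after each outcome, which all equal that of the target. Independence is a conclusion because
  it also travels backwards, from the leaves to the start.\<close>

lemma deterministic_protocol_inner:
  assumes "valid_protocol p" "norm (tri f + tri g) = 1"
    and "\<And>\<phi>. can_end p (tri f + tri g) \<phi> \<Longrightarrow> LU_equivalent (tri f0 + tri g0) \<phi>"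
    and nz: "\<And>X. det2 (f0 X) (g0 X) \<noteq> 0"
  shows "(\<forall>X. det2 (f X) (g X) \<noteq> 0) \<and> inner (tri f) (tri g) = inner (tri f0) (tri g0)"
  using assms(1-3)
proof (induction p arbitrary: f g rule: valid_protocol.induct)
  case 1
  have "LU_equivalent (tri f0 + tri g0) (tri f + tri g)"
    by (intro 1 can_end.intros)
  then obtain U where U: "\<And>X. unitary_op (U X)"
    and eq: "tri f + tri g = local_op U *v (tri f0 + tri g0)"
    unfolding LU_equivalent_iff by blast
  have eq': "tri (\<lambda>X. U X *v f0 X) + tri (\<lambda>X. U X *v g0 X) = tri f + tri g"
    by (simp add: eq matrix_vector_right_distrib local_op_tri)
  have nz': "det2 (U X *v f0 X) (U X *v g0 X) \<noteq> 0" for X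
    using nz U unitary_det_nonzero by (simp add: det2_mult)
  have "inner (tri f) (tri g) = inner (tri f0) (tri g0)"
    using decomposition_inner_unique[OF eq' nz'] inner_unitary[OF U] by (simp flip: local_op_tri)
  then show ?case
    using det2_nonzero_transfer[OF eq' nz'] by blast
next
  case (2 U p X)
  define V where "V = (\<lambda>_. mat 1)(X := U)"
  have V: "unitary_op (V Y)" for Y
    using 2 by (simp add: V_def)
  have on: "on_party X U = local_op V"
    by (simp add: on_party_eq V_def)
  have eq: "on_party X U *v (tri f + tri g) = tri (\<lambda>Y. V Y *v f Y) + tri (\<lambda>Y. V Y *v g Y)"
    by (simp add: on matrix_vector_right_distrib local_op_tri)
  have "(\<forall>Y. det2 (V Y *v f Y) (V Y *v g Y) \<noteq> 0)
      \<and> inner (tri (\<lambda>Y. V Y *v f Y)) (tri (\<lambda>Y. V Y *v g Y)) = inner (tri f0) (tri g0)"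
  proof (rule 2)
    show "norm (tri (\<lambda>Y. V Y *v f Y) + tri (\<lambda>Y. V Y *v g Y)) = 1"
      using 2 norm_unitary[of V, OF V] by (simp add: on flip: eq)
    show "LU_equivalent (tri f0 + tri g0) \<phi>"
      if "can_end p (tri (\<lambda>Y. V Y *v f Y) + tri (\<lambda>Y. V Y *v g Y)) \<phi>" for \<phi>
      using that 2(5) unfolding eq[symmetric] by (blast intro: can_end.intros)
  qed
  then show ?case
    using inner_unitary[of V, OF V] by (auto simp: det2_mult simp flip: local_op_tri)
next
  case (3 bs X)
  define \<psi> where "\<psi> = tri f + tri g"
  define r where "r = inner (tri f0) (tri g0)"
  have on: "on_party X A *v \<psi> = tri (f(X := A *v f X)) + tri (g(X := A *v g X))" for A
    by (simp add: \<psi>_def matrix_vector_right_distrib on_party_tri)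
  \<comment> \<open>Normalizing multiplies both terms by \<open>c\<close>, hence their inner product
    by the inverse of the probability; the induction hypothesis equates the result with
    \<open>r\<close>.\<close>
  have pos: "(\<forall>Y. det2 (f Y) (g Y) \<noteq> 0)
      \<and> inner (on_party X A *v tri f) (on_party X A *v tri g) = r * outcome_prob X A \<psi>"
    if A: "(A, p) \<in> set bs" and q: "outcome_prob X A \<psi> > 0" for A p
  proof -
    define c where "c = 1 / sqrt (outcome_prob X A \<psi>)"
    define f' where "f' = f(X := complex_of_real c *s (A *v f X))"
    define g' where "g' = g(X := complex_of_real c *s (A *v g X))"
    have f': "tri f' = c *\<^sub>R (on_party X A *v tri f)" and g': "tri g' = c *\<^sub>R (on_party X A *v tri g)"
      using scale_tri[of "complex_of_real c" "f(X := A *v f X)" X]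
        scale_tri[of "complex_of_real c" "g(X := A *v g X)" X]
      by (simp_all add: f'_def g'_def on_party_tri scaleR_eq_smult)
    have c: "c > 0" "c\<^sup>2 * outcome_prob X A \<psi> = 1"
      using q by (simp_all add: c_def power_divide)
    have post: "post_state X A \<psi> = tri f' + tri g'"
      by (simp add: post_state_def on f' g' c_def on_party_tri scaleR_add_right)
    have "(\<forall>Y. det2 (f' Y) (g' Y) \<noteq> 0) \<and> inner (tri f') (tri g') = inner (tri f0) (tri g0)"
    proof (rule 3(3)[OF A])
      have "norm (post_state X A \<psi>) = c * norm (on_party X A *v \<psi>)"
        using c by (simp add: post_state_def c_def)
      also have "norm (on_party X A *v \<psi>) = sqrt (outcome_prob X A \<psi>)"
        by (simp add: outcome_prob_eq)
      finally show "norm (tri f' + tri g') = 1"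
        using q by (simp add: post c_def)
      show "LU_equivalent (tri f0 + tri g0) \<phi>" if "can_end p (tri f' + tri g') \<phi>" for \<phi>
        using that A q 3(5) unfolding post[symmetric] \<psi>_def by (blast intro: can_end.intros)
    qed
    then have nz': "\<And>Y. det2 (f' Y) (g' Y) \<noteq> 0" and i: "inner (tri f') (tri g') = r"
      by (auto simp: r_def)
    have "det2 (f Y) (g Y) \<noteq> 0" for Y
      using nz'[of Y] by (cases "Y = X") (auto simp: f'_def g'_def det2_scale det2_mult)
    moreover have "r = c\<^sup>2 * inner (on_party X A *v tri f) (on_party X A *v tri g)"
      using i by (simp add: f' g' power2_eq_square)
    ultimately show ?thesis
      using c by (simp add: algebra_simps)
  qed
  have prob: "(\<Sum>(A, p)\<leftarrow>bs. outcome_prob X A \<psi>) = 1"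
    using POVM_inner[OF 3(1), of X \<psi> \<psi>] 3(4)
    by (simp add: outcome_prob_eq power2_norm_eq_inner o_def case_prod_unfold \<psi>_def norm_eq_1)
  \<comment> \<open>One outcome that does occur suffices to obtain independence at this
    node.\<close>
  have "\<exists>(A, p)\<in>set bs. outcome_prob X A \<psi> \<noteq> 0"
  proof (rule ccontr)
    assume "\<not> ?thesis"
    then have "(\<Sum>(A, p)\<leftarrow>bs. outcome_prob X A \<psi>) = (\<Sum>_\<leftarrow>bs. 0)"
      by (intro arg_cong[where f = sum_list] map_cong) auto
    then show False
      using prob by simp
  qed
  then have nz_fg: "det2 (f Y) (g Y) \<noteq> 0" for Y
    using pos by (fastforce simp: outcome_prob_eq)
  have "inner (on_party X A *v tri f) (on_party X A *v tri g) = r * outcome_prob X A \<psi>"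
    if A: "(A, p) \<in> set bs" for A p
  proof (cases "outcome_prob X A \<psi> = 0")
    case True
    \<comment> \<open>An outcome of probability zero annihilates the sum. The factors of another
      party are untouched and still independent, so each term vanishes by itself.\<close>
    obtain Y where Y: "Y \<noteq> X"
      by (metis party.distinct(1))
    have "tri (f(X := A *v f X)) = 0"
      by (rule tri_add_eq_zero[of _ "g(X := A *v g X)" Y])
        (use True Y nz_fg in \<open>simp_all add: outcome_prob_eq flip: on\<close>)
    then show ?thesis
      using True by (simp add: on_party_tri)
  next
    case False
    then show ?thesis
      using pos[OF A] by (simp add: outcome_prob_eq)
  qed
  then have "(\<Sum>(A, p)\<leftarrow>bs. inner (on_party X A *v tri f) (on_party X A *v tri g))
      = (\<Sum>(A, p)\<leftarrow>bs. r * outcome_prob X A \<psi>)"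
    by (intro arg_cong[where f = sum_list] map_cong) auto
  also have "\<dots> = r"
    using prob by (simp add: sum_list_const_mult case_prod_unfold)
  finally show ?case
    using POVM_inner[OF 3(1), of X "tri f" "tri g"] nz_fg
    by (simp add: o_def case_prod_unfold r_def)
qed

section \<open>Existence of the canonical form\<close>

definition mat2 :: "complex \<Rightarrow> complex \<Rightarrow> complex \<Rightarrow> complex \<Rightarrow> qubit_op" where
  "mat2 p q r s = (\<chi> i j. if i = 0 then if j = 0 then p else q else if j = 0 then r else s)"

lemma mat2_nth [simp]:
  "mat2 p q r s $ 0 $ 0 = p" "mat2 p q r s $ 0 $ 1 = q"
  "mat2 p q r s $ 1 $ 0 = r" "mat2 p q r s $ 1 $ 1 = s"
  by (simp_all add: mat2_def)

lemma mat2_mult_nth [simp]: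
  "(mat2 p q r s *v v) $ 0 = p * v $ 0 + q * v $ 1"
  "(mat2 p q r s *v v) $ 1 = r * v $ 0 + s * v $ 1"
  by (simp_all add: matrix_vector_mult_def sum_UNIV_2)

lemma dagger_mult_mat2:
  "dagger (mat2 p q r s) ** mat2 p q r s = mat2 (cnj p * p + cnj r * r) (cnj p * q + cnj r * s)
    (cnj q * p + cnj s * r) (cnj q * q + cnj s * s)"
  by (simp add: vec_eq_iff all_2 matrix_matrix_mult_def sum_UNIV_2 dagger_def)

lemma mat2_add: "mat2 p q r s + mat2 p' q' r' s' = mat2 (p + p') (q + q') (r + r') (s + s')"
  by (simp add: vec_eq_iff all_2)

lemma mat2_one: "mat 1 = mat2 1 0 0 1"
  by (simp add: vec_eq_iff all_2 mat_def)

lemma unitary_mat2: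
  assumes "cnj p * p + cnj r * r = 1" "cnj q * q + cnj s * s = 1" "cnj p * q + cnj r * s = 0"
  shows "unitary_op (mat2 p q r s)"
proof -
  have "cnj (cnj p * q + cnj r * s) = 0"
    using assms(3) by simp
  then have "dagger (mat2 p q r s) ** mat2 p q r s = mat 1"
    using assms by (simp add: dagger_mult_mat2 mat2_one mult.commute)
  then show ?thesis
    unfolding unitary_op_def using matrix_left_right_inverse by blast
qed

lemma cinner_self: "cinner u u = complex_of_real ((norm u)\<^sup>2)"
proof -
  have "(norm u)\<^sup>2 = (cmod (u $ 0))\<^sup>2 + (cmod (u $ 1))\<^sup>2"
    unfolding power2_norm_eq_inner inner_vec_def sum_UNIV_2 ..
  then have "complex_of_real ((norm u)\<^sup>2) = u $ 0 * cnj (u $ 0) + u $ 1 * cnj (u $ 1)"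
    by (simp only: of_real_add complex_norm_square)
  then show ?thesis
    by (simp add: cinner_def mult.commute)
qed

lemma norm_tri: "norm (tri f) = (\<Prod>X\<in>UNIV. norm (f X))"
proof (rule power2_eq_imp_eq)
  show "(norm (tri f))\<^sup>2 = (\<Prod>X\<in>UNIV. norm (f X))\<^sup>2"
    by (simp add: power2_norm_eq_inner[of "tri f"] inner_tri cinner_self prod_power_distrib
        flip: of_real_prod of_real_power)
qed (simp_all add: prod_nonneg)

lemma tilted_ket_nth [simp]: "tilted_ket \<delta> $ 0 = cos \<delta>" "tilted_ket \<delta> $ 1 = sin \<delta>"
  by (simp_all add: tilted_ket_def)

lemma norm_ket [simp]: "norm (ket i) = 1"
  by (simp add: ket_def)

lemma norm_tilted_ket [simp]: "norm (tilted_ket \<delta>) = 1"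
proof -
  have "complex_of_real ((norm (tilted_ket \<delta>))\<^sup>2) = complex_of_real (cos \<delta> * cos \<delta> + sin \<delta> * sin \<delta>)"
    unfolding cinner_self[symmetric] by (simp add: cinner_def flip: of_real_mult of_real_add)
  then have "(norm (tilted_ket \<delta>))\<^sup>2 = 1"
    unfolding of_real_eq_iff by simp
  then show ?thesis
    using norm_ge_zero[of "tilted_ket \<delta>"] by (auto simp: power2_eq_1_iff)
qed

text \<open>A unitary taking \<open>u\<close> to the direction of \<open>ket 0\<close> is free up to
  a phase on the complement. This phase is used to give both components of the image of
  \<open>v\<close> a common argument.\<close>

lemma qubit_pair_normal_form:
  assumes nz: "det2 u v \<noteq> 0"
  shows "\<exists>U \<delta> \<theta>. unitary_op U \<and> \<delta> \<in> {0<..pi / 2} \<and> U *v u = complex_of_real (norm u) *s ket 0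
    \<and> U *v v = (complex_of_real (norm v) * cis \<theta>) *s tilted_ket \<delta>"
proof -
  define n m where "n = norm u" and "m = norm v"
  have "u \<noteq> 0" "v \<noteq> 0"
    using nz by (auto simp: det2_def)
  then have n: "n > 0" and m: "m > 0"
    by (simp_all add: n_def m_def)
  \<comment> \<open>The components of \<open>v\<close> along \<open>u\<close> and along its
    orthogonal complement; \<open>w\<close> turns the second to the argument of the first.\<close>
  define s t where "s = cinner u v / n" and "t = det2 u v / n"
  define w where "w = cis (Arg s - Arg t)"
  define U where "U = mat2 (cnj (u $ 0) / n) (cnj (u $ 1) / n) (- w * u $ 1 / n) (w * u $ 0 / n)"
  have uu: "cnj (u $ 0) * u $ 0 + cnj (u $ 1) * u $ 1 = n * n"
    using cinner_self[of u] by (simp add: cinner_def n_def power2_eq_square)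
  have ww: "cnj w * w = 1"
    by (simp add: w_def cis_cnj cis_mult)
  have unit: "unitary_op U"
  proof -
    have w_cancel: "w * (cnj w * x) = x" for x
      using ww by algebra
    show ?thesis
      unfolding U_def using n uu ww
      by (intro unitary_mat2) (simp_all add: field_simps w_cancel)
  qed
  have Uu: "U *v u = complex_of_real n *s ket 0"
    using n uu by (simp add: vec_eq_iff all_2 U_def field_simps)
  have Uv: "(U *v v) $ 0 = s" "(U *v v) $ 1 = w * t"
    using n by (simp_all add: U_def s_def t_def cinner_def det2_def field_simps)
  have polar: "z = cmod z * cis (Arg z)" for z
    using rcis_cmod_Arg[of z] by (simp add: rcis_def)
  have w_t: "w * t = cmod t * cis (Arg s)"
    by (subst polar[of t]) (simp add: w_def cis_mult)
  \<comment> \<open>Lagrange's identity for \<open>cinner\<close> and \<open>det2\<close>; it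
    supplies the angle \<delta>.\<close>
  have st: "(cmod s / m)\<^sup>2 + (cmod t / m)\<^sup>2 = 1"
  proof -
    have "complex_of_real ((cmod s)\<^sup>2 + (cmod t)\<^sup>2) = complex_of_real (m * m)"
    proof -
      have vv: "cnj (v $ 0) * v $ 0 + cnj (v $ 1) * v $ 1 = m * m"
        using cinner_self[of v] by (simp add: cinner_def m_def power2_eq_square)
      have "s * cnj s + t * cnj t = (cnj (u $ 0) * u $ 0 + cnj (u $ 1) * u $ 1)
          * (cnj (v $ 0) * v $ 0 + cnj (v $ 1) * v $ 1) / (n * n)"
        using n by (simp add: s_def t_def cinner_def det2_def field_simps)
      also have "\<dots> = m * m"
        unfolding uu vv using n by simp
      finally show ?thesis
        by (simp only: of_real_add complex_norm_square)
    qed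
    then have "(cmod s)\<^sup>2 + (cmod t)\<^sup>2 = m\<^sup>2"
      unfolding of_real_eq_iff by (simp add: power2_eq_square)
    then show ?thesis
      using m by (simp add: power_divide flip: add_divide_distrib)
  qed
  obtain \<delta> where \<delta>: "0 \<le> \<delta>" "\<delta> \<le> pi / 2" "cmod s / m = cos \<delta>" "cmod t / m = sin \<delta>"
    using sincos_total_pi_half[OF _ _ st] m by auto
  have "sin \<delta> \<noteq> 0"
    using \<delta>(4) m n nz by (auto simp: t_def)
  then have "\<delta> \<in> {0<..pi / 2}"
    using \<delta> by (cases "\<delta> = 0") auto
  moreover have "U *v v = (complex_of_real m * cis (Arg s)) *s tilted_ket \<delta>"
  proof -
    have "m * cos \<delta> = cmod s" "m * sin \<delta> = cmod t"
      using m by (simp_all flip: \<delta>(3,4))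
    then have mc: "complex_of_real m * cos \<delta> = cmod s" "complex_of_real m * sin \<delta> = cmod t"
      by (metis of_real_mult)+
    have "complex_of_real m * cis (Arg s) * cos \<delta> = complex_of_real m * cos \<delta> * cis (Arg s)"
        "complex_of_real m * cis (Arg s) * sin \<delta> = complex_of_real m * sin \<delta> * cis (Arg s)"
      by simp_all
    then have "complex_of_real m * cis (Arg s) * cos \<delta> = s"
        "complex_of_real m * cis (Arg s) * sin \<delta> = w * t"
      unfolding mc w_t polar[of s, symmetric] by simp_all
    then show ?thesis
      by (simp add: vec_eq_iff all_2 Uv)
  qed
  ultimately show ?thesis
    using unit Uu unfolding n_def m_def by blast
qed

lemma scale_tri_all: "tri (\<lambda>X. z X *s f X) = (\<Prod>X\<in>UNIV. z X) *s tri f"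
  by (simp add: vec_eq_iff UNIV_party)

text \<open>The phase enters as a number \<open>w\<close>, so that it can be negated directly when a
  measurement flips the sign of the second term.\<close>

definition canonical_sum :: "real \<Rightarrow> real \<Rightarrow> complex \<Rightarrow> (party \<Rightarrow> real) \<Rightarrow> three_qubits" where
  "canonical_sum \<mu> \<nu> w \<delta> =
    complex_of_real \<mu> *s tri (\<lambda>_. ket 0) + (complex_of_real \<nu> * w) *s tri (\<lambda>X. tilted_ket (\<delta> X))"

lemma is_Omega_iff:
  "is_Omega \<psi> \<omega> \<longleftrightarrow> (\<exists>\<mu> \<nu> \<gamma> \<delta>. \<nu> > 0 \<and> \<mu> \<ge> \<nu> \<and> \<gamma> \<in> {0..<2 * pi} \<and> (\<forall>X. \<delta> X \<in> {0<..pi / 2})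
    \<and> LU_equivalent \<psi> (canonical_sum \<mu> \<nu> (cis \<gamma>) \<delta>)
    \<and> \<omega> = complex_of_real (\<mu> * \<nu>) * cis \<gamma> * (\<Prod>X\<in>UNIV. cos (\<delta> X)))" (is "_ \<longleftrightarrow> ?R")
proof -
  have eq: "canonical_form \<mu> \<nu> \<gamma> (\<delta> Alice) (\<delta> Bob) (\<delta> Charlie) = canonical_sum \<mu> \<nu> (cis \<gamma>) \<delta>" for \<mu> \<nu> \<gamma> \<delta>
    by (simp add: canonical_form_def canonical_sum_def tri_def)
  show ?thesis
  proof
    assume "is_Omega \<psi> \<omega>"
    then obtain \<mu> \<nu> \<gamma> a b c where *: "canonical_params \<mu> \<nu> \<gamma> a b c"
        "LU_equivalent \<psi> (canonical_form \<mu> \<nu> \<gamma> a b c)"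
        "\<omega> = complex_of_real (\<mu> * \<nu>) * cis \<gamma> * complex_of_real (cos a * cos b * cos c)"
      unfolding is_Omega_def by blast
    show ?R
      by (rule exI[of _ \<mu>], rule exI[of _ \<nu>], rule exI[of _ \<gamma>], rule exI[of _ "case_party a b c"])
        (use * in \<open>simp add: canonical_params_def all_party UNIV_party mult.assoc flip: eq\<close>)
  next
    assume ?R
    then obtain \<mu> \<nu> \<gamma> \<delta> where *: "\<nu> > 0" "\<mu> \<ge> \<nu>" "\<gamma> \<in> {0..<2 * pi}" "\<forall>X. \<delta> X \<in> {0<..pi / 2}"
        "LU_equivalent \<psi> (canonical_sum \<mu> \<nu> (cis \<gamma>) \<delta>)"
        "\<omega> = complex_of_real (\<mu> * \<nu>) * cis \<gamma> * (\<Prod>X\<in>UNIV. cos (\<delta> X))"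
      by blast
    show "is_Omega \<psi> \<omega>"
      unfolding is_Omega_def
      by (rule exI[of _ \<mu>], rule exI[of _ \<nu>], rule exI[of _ \<gamma>], rule exI[of _ "\<delta> Alice"],
          rule exI[of _ "\<delta> Bob"], rule exI[of _ "\<delta> Charlie"])
        (use * in \<open>simp add: canonical_params_def UNIV_party eq mult.assoc\<close>)
  qed
qed

text \<open>The term of larger norm is rotated onto \<mu> times
  \<open>tri (\<lambda>_. ket 0)\<close>; the phases left at the three parties multiply to a single
  relative phase.\<close>

lemma is_Omega_exists:
  assumes "\<And>X. det2 (f X) (g X) \<noteq> 0"
  shows "\<exists>\<omega>. is_Omega (tri f + tri g) \<omega>"
proof -
  have ordered: "\<exists>\<omega>. is_Omega (tri f + tri g) \<omega>"
    if nz: "\<And>X. det2 (f X) (g X) \<noteq> 0" and le: "norm (tri g) \<le> norm (tri f)" for f g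
  proof -
    have "\<forall>X. \<exists>U \<delta> \<theta>. unitary_op U \<and> \<delta> \<in> {0<..pi / 2} \<and> U *v f X = complex_of_real (norm (f X)) *s ket 0
        \<and> U *v g X = (complex_of_real (norm (g X)) * cis \<theta>) *s tilted_ket \<delta>"
      using qubit_pair_normal_form nz by blast
    then obtain U \<delta> \<theta> where U: "\<And>X. unitary_op (U X)" and \<delta>: "\<And>X. \<delta> X \<in> {0<..pi / 2}"
      and Uf: "\<And>X. U X *v f X = complex_of_real (norm (f X)) *s ket 0"
      and Ug: "\<And>X. U X *v g X = (complex_of_real (norm (g X)) * cis (\<theta> X)) *s tilted_ket (\<delta> X)"
      by metis
    define w where "w = (\<Prod>X\<in>UNIV. cis (\<theta> X))"
    have "cmod w = 1"
      by (simp add: w_def UNIV_party norm_mult)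
    \<comment> \<open>\<open>Arg2pi\<close> rather than \<open>Arg\<close>, since \<gamma> has to
      lie in \<open>{0..<2 * pi}\<close>.\<close>
    then have w: "w = cis (Arg2pi w)"
      using Arg2pi_eq[of w] by (simp add: cis_conv_exp)
    have "local_op U *v (tri f + tri g) = canonical_sum (norm (tri f)) (norm (tri g)) w \<delta>"
      by (simp only: matrix_vector_right_distrib local_op_tri Uf Ug scale_tri_all)
        (simp add: canonical_sum_def norm_tri prod.distrib w_def)
    then have LU: "LU_equivalent (tri f + tri g) (canonical_sum (norm (tri f)) (norm (tri g)) w \<delta>)"
      using U by (intro LU_equivalentI[of U])
    have "g X \<noteq> 0" for X
      using nz[of X] by (auto simp: det2_def)
    then have "norm (tri g) > 0"
      by (auto simp: norm_tri intro: prod_pos)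
    have "is_Omega (tri f + tri g)
        (complex_of_real (norm (tri f) * norm (tri g)) * cis (Arg2pi w) * (\<Prod>X\<in>UNIV. cos (\<delta> X)))"
      unfolding is_Omega_iff
      by (rule exI[of _ "norm (tri f)"], rule exI[of _ "norm (tri g)"],
          rule exI[of _ "Arg2pi w"], rule exI[of _ \<delta>])
        (use \<open>norm (tri g) > 0\<close> LU le \<delta> Arg2pi_ge_0[of w] Arg2pi_lt_2pi[of w] in \<open>simp flip: w\<close>)
    then show ?thesis ..
  qed
  show ?thesis
  proof (cases "norm (tri g) \<le> norm (tri f)")
    case True
    then show ?thesis
      using ordered assms by blast
  next
    case False
    have "det2 (g X) (f X) \<noteq> 0" for X
      using assms[of X] by (auto simp: det2_def algebra_simps)
    then show ?thesis
      using ordered[of g f] False by (simp add: add.commute)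
  qed
qed

section \<open>Two-term decompositions of GHZ class states and of canonical forms\<close>

lemma GHZ_decomposition:
  "\<exists>f g. GHZ = tri f + tri g \<and> (\<forall>X. det2 (f X) (g X) \<noteq> 0) \<and> inner (tri f) (tri g) = 0"
proof -
  define f g where "f = (\<lambda>_. ket 0)(Alice := complex_of_real (1 / sqrt 2) *s ket 0)"
    and "g = (\<lambda>_. ket 1)(Alice := complex_of_real (1 / sqrt 2) *s ket 1)"
  have "GHZ = tri f + tri g"
    by (simp add: GHZ_def f_def g_def scaleR_eq_smult vec_eq_iff tensor_vec_def algebra_simps)
  moreover have "det2 (f X) (g X) \<noteq> 0" for X
    by (simp add: f_def g_def det2_def)
  moreover have "inner (tri f) (tri g) = 0"
    by (simp add: inner_tri UNIV_party cinner_def f_def g_def)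
  ultimately show ?thesis
    by blast
qed

lemma in_GHZ_class_decomposition:
  assumes "in_GHZ_class \<psi>"
  shows "\<exists>f g. \<psi> = tri f + tri g \<and> (\<forall>X. det2 (f X) (g X) \<noteq> 0)"
proof -
  obtain gA gB gC where inv: "invertible gA" "invertible gB" "invertible gC"
    and \<psi>: "\<psi> = tensor_op gA gB gC *v GHZ"
    using assms unfolding in_GHZ_class_def by blast
  define G where "G = case_party gA gB gC"
  obtain f g where fg: "GHZ = tri f + tri g" "\<And>X. det2 (f X) (g X) \<noteq> 0"
    using GHZ_decomposition by blast
  have "det (G X) \<noteq> 0" for X
    using inv by (cases X) (simp_all add: G_def invertible_det_nz)
  moreover have "\<psi> = tri (\<lambda>X. G X *v f X) + tri (\<lambda>X. G X *v g X)"
    unfolding local_op_tri[symmetric] matrix_vector_right_distrib[symmetric] fg(1)[symmetric] \<psi>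
    by (simp add: local_op_def G_def)
  ultimately show ?thesis
    using fg(2) by (intro exI[of _ "\<lambda>X. G X *v f X"] exI[of _ "\<lambda>X. G X *v g X"]) (simp add: det2_mult)
qed

text \<open>Whichever value \<open>SOME\<close> selects, it comes with a canonical form having
  exactly this value.\<close>

lemma in_GHZ_class_Omega: "in_GHZ_class \<psi> \<Longrightarrow> is_Omega \<psi> (Omega \<psi>)"
  unfolding Omega_def using in_GHZ_class_decomposition is_Omega_exists by (blast intro: someI_ex)

text \<open>Alice's factors absorb the coefficients. The scalar \<open>z\<close> gives access to
  both parts of \<Omega>: the value 1 yields its real part, the imaginary unit its imaginary
  part.\<close>

lemma canonical_sum_decomposition:
  assumes "\<mu> > 0" "\<nu> > 0" "\<And>X. \<delta> X \<in> {0<..pi / 2}"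
  obtains f g where "canonical_sum \<mu> \<nu> (cis \<gamma>) \<delta> = tri f + tri g"
    "\<And>X. det2 (f X) (g X) \<noteq> 0"
    "tri f = complex_of_real \<mu> *s tri (\<lambda>_. ket 0)"
    "tri g = (complex_of_real \<nu> * cis \<gamma>) *s tri (\<lambda>X. tilted_ket (\<delta> X))"
    "\<And>z. inner (z *s tri f) (tri g) = Re (cnj z * complex_of_real (\<mu> * \<nu>) * cis \<gamma> * (\<Prod>X\<in>UNIV. cos (\<delta> X)))"
proof
  define f g where "f = (\<lambda>_. ket 0)(Alice := complex_of_real \<mu> *s ket 0)"
    and "g = (\<lambda>X. tilted_ket (\<delta> X))(Alice := (complex_of_real \<nu> * cis \<gamma>) *s tilted_ket (\<delta> Alice))"
  show f: "tri f = complex_of_real \<mu> *s tri (\<lambda>_. ket 0)"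
    and g: "tri g = (complex_of_real \<nu> * cis \<gamma>) *s tri (\<lambda>X. tilted_ket (\<delta> X))"
    by (simp_all add: f_def g_def scale_tri[of _ _ Alice])
  show "canonical_sum \<mu> \<nu> (cis \<gamma>) \<delta> = tri f + tri g"
    by (simp add: f g canonical_sum_def)
  show "det2 (f X) (g X) \<noteq> 0" for X
  proof -
    have "sin (\<delta> X) > 0"
      using assms(3)[of X] by (intro sin_gt_zero) auto
    then show ?thesis
      using assms(1,2) by (cases "X = Alice") (auto simp: f_def g_def det2_def)
  qed
  show "inner (z *s tri f) (tri g) = Re (cnj z * complex_of_real (\<mu> * \<nu>) * cis \<gamma> * (\<Prod>X\<in>UNIV. cos (\<delta> X)))" for z
    unfolding scale_tri[of z f Alice] inner_tri
    by (intro arg_cong[where f = Re])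
      (simp add: f_def g_def UNIV_party cinner_def algebra_simps)
qed

text \<open>
  Complex conjugation fixes the real representative, so by uniqueness it fixes or swaps its two
  product terms. In the first case \<open>\<Omega>\<close> is real, in the second one both terms have the same norm.
\<close>

lemma real_state_canonical_params:
  assumes "real_state \<psi>" and LU: "LU_equivalent \<psi> (canonical_sum \<mu> \<nu> (cis \<gamma>) \<delta>)"
    and params: "\<mu> > 0" "\<nu> > 0" "\<And>X. \<delta> X \<in> {0<..pi / 2}"
    and Re0: "Re (complex_of_real (\<mu> * \<nu>) * cis \<gamma> * (\<Prod>X\<in>UNIV. cos (\<delta> X))) = 0"
  shows "(\<exists>X. cos (\<delta> X) = 0) \<or> (\<mu> = \<nu> \<and> cos \<gamma> = 0)"
proof (rule disjCI)
  assume nc: "\<not> (\<mu> = \<nu> \<and> cos \<gamma> = 0)"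
  define P where "P = (\<Prod>X\<in>UNIV. cos (\<delta> X))"
  have Re: "cos \<gamma> * P = 0"
    using Re0 params by (simp add: P_def del: of_real_prod)
  have "P = 0"
  proof (rule ccontr)
    assume P: "P \<noteq> 0"
    with Re have cos: "cos \<gamma> = 0"
      by simp
    obtain \<phi> where \<phi>: "LU_equivalent \<psi> \<phi>" and real: "\<And>i. \<phi> $ i \<in> \<real>"
      using \<open>real_state \<psi>\<close> unfolding real_state_def by blast
    have "LU_equivalent (canonical_sum \<mu> \<nu> (cis \<gamma>) \<delta>) \<phi>"
      using LU \<phi> LU_equivalent_sym LU_equivalent_trans by blast
    then obtain U where U: "\<And>X. unitary_op (U X)" and \<phi>U: "\<phi> = local_op U *v canonical_sum \<mu> \<nu> (cis \<gamma>) \<delta>"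
      unfolding LU_equivalent_iff by blast
    obtain f g where fg: "canonical_sum \<mu> \<nu> (cis \<gamma>) \<delta> = tri f + tri g"
      and nz: "\<And>X. det2 (f X) (g X) \<noteq> 0"
      and f: "tri f = complex_of_real \<mu> *s tri (\<lambda>_. ket 0)"
      and g: "tri g = (complex_of_real \<nu> * cis \<gamma>) *s tri (\<lambda>X. tilted_ket (\<delta> X))"
      and inner: "\<And>z. inner (z *s tri f) (tri g) = Re (cnj z * complex_of_real (\<mu> * \<nu>) * cis \<gamma> * P)"
      unfolding P_def using canonical_sum_decomposition[of \<mu> \<nu> \<delta> \<gamma>] params by metis
    define s t where "s = (\<lambda>X. U X *v f X)" and "t = (\<lambda>X. U X *v g X)"
    have s: "tri s = local_op U *v tri f" and t: "tri t = local_op U *v tri g"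
      by (simp_all add: local_op_tri s_def t_def)
    have st: "\<phi> = tri s + tri t"
      by (simp add: \<phi>U fg matrix_vector_right_distrib s t)
    define cv where "cv v = (\<chi> i. cnj (v $ i))" for v :: qubit
    have cv: "tri (\<lambda>X. cv (v X)) $ i = cnj (tri v $ i)" for v i
      by (cases i) (simp add: cv_def)
    \<comment> \<open>The real vector equals its conjugate, which gives a second decomposition to
      compare with the first.\<close>
    have "tri s + tri t = tri (\<lambda>X. cv (s X)) + tri (\<lambda>X. cv (t X))"
    proof -
      have "cnj (\<phi> $ i) = \<phi> $ i" for i
        using real[of i] by (simp add: Reals_cnj_iff)
      then show ?thesis
        by (simp only: st vec_eq_iff vector_add_component cv complex_cnj_add) simp
    qed
    moreover have "det2 (s X) (t X) \<noteq> 0" for X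
      using nz U unitary_det_nonzero by (simp add: s_def t_def det2_mult)
    ultimately consider "tri (\<lambda>X. cv (s X)) = tri s" "tri (\<lambda>X. cv (t X)) = tri t"
      | "tri (\<lambda>X. cv (s X)) = tri t"
      using product_decomposition_unique by blast
    then show False
    proof cases
      case 1
      have r: "Im (tri s $ i) = 0" "Im (tri t $ i) = 0" for i
        using arg_cong[OF 1(1), of "\<lambda>v. Im (v $ i)"] arg_cong[OF 1(2), of "\<lambda>v. Im (v $ i)"]
        by (simp_all add: cv)
      \<comment> \<open>This is the imaginary part of \<Omega>. It vanishes because both terms now
        have real entries, whereas \<open>cos \<gamma> = 0\<close> and \<open>P \<noteq> 0\<close>
        forbid that.\<close>
      have "inner (\<i> *s tri f) (tri g) = inner (\<i> *s tri s) (tri t)"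
        using inner_unitary[OF U, where \<psi> = "\<i> *s tri f" and \<phi> = "tri g"] by (simp add: s t mult_scale)
      also have "\<dots> = 0"
        by (simp add: inner_vec_def inner_complex_def r)
      finally have "sin \<gamma> = 0"
        using P params by (simp add: inner)
      with cos show False
        using sin_cos_squared_add[of \<gamma>] by simp
    next
      case 2
      have "norm (tri s) = norm (tri t)"
        unfolding 2[symmetric] by (simp add: norm_vec_def cv)
      then have "\<mu> = \<nu>"
        using params by (simp add: s t norm_unitary[OF U] f g norm_smult norm_mult norm_tri)
      then show False
        using nc cos by blast
    qed
  qed
  then show "\<exists>X. cos (\<delta> X) = 0"
    by (auto simp: P_def UNIV_party)
qed

section \<open>Protocols starting from the GHZ state\<close>

inductive_cases can_end_FinishE: "can_end Finish \<psi> \<phi>"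
inductive_cases can_end_RotateE: "can_end (Rotate X U p) \<psi> \<phi>"
inductive_cases can_end_MeasureE: "can_end (Measure X bs) \<psi> \<phi>"

lemma LOCC_transforms_LU: "LU_equivalent \<xi> \<psi> \<Longrightarrow> LOCC_transforms \<psi> \<xi>"
  unfolding LOCC_transforms_def
  by (rule exI[of _ Finish]) (auto intro: valid_protocol.intros elim: can_end_FinishE)

lemma LOCC_transforms_rotate:
  assumes "unitary_op U" "LOCC_transforms (on_party X U *v \<psi>) \<xi>"
  shows "LOCC_transforms \<psi> \<xi>"
proof -
  obtain p where "valid_protocol p" "\<And>\<phi>. can_end p (on_party X U *v \<psi>) \<phi> \<Longrightarrow> LU_equivalent \<xi> \<phi>"
    using assms(2) unfolding LOCC_transforms_def by blast
  then show ?thesis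
    unfolding LOCC_transforms_def using assms(1)
    by (intro exI[of _ "Rotate X U p"]) (auto intro: valid_protocol.intros elim: can_end_RotateE)
qed

text \<open>The factor \<open>1 / sqrt 2\<close> expresses that both outcomes have probability 1/2,
  as in every measurement of the protocols below.\<close>

lemma LOCC_transforms_measure:
  assumes AB: "dagger A ** A + dagger B ** B = mat 1"
    and A: "on_party X A *v \<psi> = (1 / sqrt 2) *\<^sub>R \<psi>A" "norm \<psi>A = 1" "LOCC_transforms \<psi>A \<xi>"
    and B: "on_party X B *v \<psi> = (1 / sqrt 2) *\<^sub>R \<psi>B" "norm \<psi>B = 1" "LOCC_transforms \<psi>B \<xi>"
  shows "LOCC_transforms \<psi> \<xi>"
proof -
  obtain p where p: "valid_protocol p" "\<And>\<phi>. can_end p \<psi>A \<phi> \<Longrightarrow> LU_equivalent \<xi> \<phi>"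
    using A unfolding LOCC_transforms_def by blast
  obtain q where q: "valid_protocol q" "\<And>\<phi>. can_end q \<psi>B \<phi> \<Longrightarrow> LU_equivalent \<xi> \<phi>"
    using B unfolding LOCC_transforms_def by blast
  have post: "post_state X A \<psi> = \<psi>A" "post_state X B \<psi> = \<psi>B"
    by (simp_all add: post_state_def outcome_prob_eq A B power_divide real_sqrt_divide)
  show ?thesis
    unfolding LOCC_transforms_def
  proof (intro exI conjI allI impI)
    show "valid_protocol (Measure X [(A, p), (B, q)])"
      using p q AB by (intro valid_protocol.intros) (auto simp: is_POVM_def)
    show "LU_equivalent \<xi> \<phi>" if "can_end (Measure X [(A, p), (B, q)]) \<psi> \<phi>" for \<phi>
      using that by (rule can_end_MeasureE) (use p q post in auto)
  qed
qed

text \<open>The intermediate states of the protocols: the first term stays at \<open>ket 0\<close>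
  for all parties while the factors of the second are moved one by one.\<close>

definition pair_state :: "(party \<Rightarrow> qubit) \<Rightarrow> three_qubits" where
  "pair_state g = (1 / sqrt 2) *\<^sub>R (tri (\<lambda>_. ket 0) + tri g)"

text \<open>Orthogonal factors at the single party \<open>Y\<close> already make the two product
  vectors orthogonal.\<close>

lemma norm_pair_state:
  assumes "\<And>X. norm (g X) = 1" "g Y = z *s ket 1"
  shows "norm (pair_state g) = 1"
proof -
  have "cinner (ket 0) (g Y) = 0"
    by (simp add: assms(2) cinner_def)
  then have "inner (tri (\<lambda>_. ket 0)) (tri g) = 0"
    by (cases Y) (simp_all add: inner_tri UNIV_party)
  moreover have "norm (tri (\<lambda>_. ket 0)) = 1" "norm (tri g) = 1"
    by (simp_all add: norm_tri assms)
  ultimately have "(norm (tri (\<lambda>_. ket 0) + tri g))\<^sup>2 = 2"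
    by (simp add: power2_norm_eq_inner inner_add_left inner_add_right inner_commute norm_eq_1)
  then have "norm (tri (\<lambda>_. ket 0) + tri g) = sqrt 2"
    by (metis norm_ge_zero real_sqrt_unique)
  then show ?thesis
    by (simp add: pair_state_def)
qed

lemma GHZ_eq_pair_state: "GHZ = pair_state (\<lambda>_. ket 1)"
  by (simp add: GHZ_def pair_state_def tri_def)

text \<open>The sign \<open>e = \<plusminus>1\<close> labels the outcome.\<close>

definition tilt_op :: "real \<Rightarrow> real \<Rightarrow> qubit_op" where
  "tilt_op e \<delta> = mat2 (1 / sqrt 2) (e * cos \<delta> / sqrt 2) 0 (e * sin \<delta> / sqrt 2)"

text \<open>Each element contributes 1/2 on the diagonal; the off-diagonal entries have opposite
  signs and cancel.\<close>

lemma tilt_op_complete: "dagger (tilt_op 1 \<delta>) ** tilt_op 1 \<delta> + dagger (tilt_op (-1) \<delta>) ** tilt_op (-1) \<delta> = mat 1"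
proof -
  have "complex_of_real (sqrt 2) * complex_of_real (sqrt 2) = 2"
    by (simp flip: of_real_mult)
  moreover have "2 * (complex_of_real (cos \<delta>) * complex_of_real (cos \<delta>))
      + 2 * (complex_of_real (sin \<delta>) * complex_of_real (sin \<delta>)) = 2"
    by (simp flip: of_real_mult of_real_add distrib_left)
  ultimately show ?thesis
    by (simp add: tilt_op_def dagger_mult_mat2 mat2_add mat2_one flip: add_divide_distrib)
qed

lemma tilt_op_ket:
  "tilt_op e \<delta> *v ket 0 = complex_of_real (1 / sqrt 2) *s ket 0"
  "tilt_op e \<delta> *v (z *s ket 1) = complex_of_real (1 / sqrt 2) *s ((complex_of_real e * z) *s tilted_ket \<delta>)"
  by (simp_all add: vec_eq_iff all_2 tilt_op_def)

lemma tilt_op_pair_state: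
  assumes "g X = z *s ket 1"
  shows "on_party X (tilt_op e \<delta>) *v pair_state g
    = (1 / sqrt 2) *\<^sub>R pair_state (g(X := (complex_of_real e * z) *s tilted_ket \<delta>))"
  unfolding pair_state_def scaleR_eq_smult mult_scale
  unfolding matrix_vector_right_distrib on_party_tri assms tilt_op_ket
    scale_tri[of "complex_of_real (1 / sqrt 2)" "\<lambda>_. ket 0" X, symmetric]
  by (cases X) (simp_all add: vec_eq_iff algebra_simps)

lemma mat2_diag_ket [simp]:
  "mat2 p 0 0 s *v ket 0 = p *s ket 0" "mat2 p 0 0 s *v (z *s ket 1) = (s * z) *s ket 1"
  "mat2 p 0 0 s *v ket 1 = s *s ket 1"
  by (simp_all add: vec_eq_iff all_2)

text \<open>The sign of the unwanted outcome is undone by another party, whose factors are still orthogonal.\<close>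

lemma LOCC_transforms_tilt:
  assumes g: "\<And>X. norm (g X) = 1" "g X = ket 1" "g Y = ket 1" "X \<noteq> Y"
    and tilted: "LOCC_transforms (pair_state (g(X := tilted_ket \<delta>))) \<xi>"
  shows "LOCC_transforms (pair_state g) \<xi>"
proof (rule LOCC_transforms_measure[OF tilt_op_complete[of \<delta>]])
  have gX: "g X = 1 *s ket 1"
    by (simp add: g)
  show "on_party X (tilt_op 1 \<delta>) *v pair_state g = (1 / sqrt 2) *\<^sub>R pair_state (g(X := tilted_ket \<delta>))"
    using tilt_op_pair_state[of g X 1 1 \<delta>, OF gX] by simp
  show "on_party X (tilt_op (-1) \<delta>) *v pair_state g = (1 / sqrt 2) *\<^sub>R pair_state (g(X := (-1) *s tilted_ket \<delta>))"
    using tilt_op_pair_state[of g X 1 "-1" \<delta>, OF gX] by simp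
  show "norm (pair_state (g(X := tilted_ket \<delta>))) = 1" "norm (pair_state (g(X := (-1) *s tilted_ket \<delta>))) = 1"
    by (rule norm_pair_state[of _ Y 1]; use g in \<open>auto simp: vector_smult_lneg\<close>)+
  show "LOCC_transforms (pair_state (g(X := tilted_ket \<delta>))) \<xi>"
    by (fact tilted)
  show "LOCC_transforms (pair_state (g(X := (-1) *s tilted_ket \<delta>))) \<xi>"
  proof (rule LOCC_transforms_rotate[of "mat2 1 0 0 (-1)" Y])
    show "unitary_op (mat2 1 0 0 (-1))"
      by (rule unitary_mat2) simp_all
    have "tri ((g(X := (-1) *s tilted_ket \<delta>))(Y := (-1) *s ket 1)) = tri (g(X := tilted_ket \<delta>))"
      using g(3,4) by (cases X; cases Y) (simp_all add: vec_eq_iff)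
    then have "on_party Y (mat2 1 0 0 (-1)) *v pair_state (g(X := (-1) *s tilted_ket \<delta>))
        = pair_state (g(X := tilted_ket \<delta>))"
      using g(3,4) by (simp add: pair_state_def scaleR_eq_smult mult_scale matrix_vector_right_distrib
          on_party_tri fun_upd_idem)
    then show "LOCC_transforms (on_party Y (mat2 1 0 0 (-1)) *v pair_state (g(X := (-1) *s tilted_ket \<delta>))) \<xi>"
      using tilted by simp
  qed
qed

text \<open>The other two parties tilt in turn. The factors of \<open>X\<close> stay orthogonal
  meanwhile, so signs can be corrected, and \<open>X\<close> finally inserts the phase by a diagonal
  unitary. The proof runs backwards from the last step.\<close>

lemma LOCC_transforms_GHZ:
  assumes "LOCC_transforms (pair_state ((\<lambda>X. tilted_ket (\<delta> X))(X := cis \<gamma> *s ket 1))) \<xi>"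
  shows "LOCC_transforms GHZ \<xi>"
proof -
  obtain Y Z where YZ: "Y \<noteq> X" "Z \<noteq> X" "Y \<noteq> Z" "\<And>P. P = X \<or> P = Y \<or> P = Z"
    by (metis party.distinct(1,3,5) party.exhaust)
  define g where "g = ((\<lambda>_. ket 1)(Y := tilted_ket (\<delta> Y)))(Z := tilted_ket (\<delta> Z))"
  have "g(X := cis \<gamma> *s ket 1) = (\<lambda>X. tilted_ket (\<delta> X))(X := cis \<gamma> *s ket 1)"
    using YZ by (auto simp: g_def fun_eq_iff)
  then have "on_party X (mat2 1 0 0 (cis \<gamma>)) *v pair_state g
      = pair_state ((\<lambda>X. tilted_ket (\<delta> X))(X := cis \<gamma> *s ket 1))"
    using YZ by (simp add: pair_state_def scaleR_eq_smult mult_scale matrix_vector_right_distrib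
        on_party_tri fun_upd_idem g_def)
  moreover have "unitary_op (mat2 1 0 0 (cis \<gamma>))"
    by (rule unitary_mat2) (simp_all add: cis_cnj cis_mult)
  ultimately have "LOCC_transforms (pair_state g) \<xi>"
    using assms by (metis LOCC_transforms_rotate)
  then have "LOCC_transforms (pair_state ((\<lambda>_. ket 1)(Y := tilted_ket (\<delta> Y)))) \<xi>"
    unfolding g_def by (rule LOCC_transforms_tilt[rotated -1]) (use YZ in auto)
  then show ?thesis
    unfolding GHZ_eq_pair_state by (rule LOCC_transforms_tilt[rotated -1]) (use YZ in auto)
qed

section \<open>Norm of a canonical sum and exchange of its terms\<close>

lemma norm_canonical_sum:
  assumes "cmod w = 1"
  shows "(norm (canonical_sum \<mu> \<nu> w \<delta>))\<^sup>2
    = \<mu>\<^sup>2 + \<nu>\<^sup>2 + 2 * \<mu> * \<nu> * Re (w * complex_of_real (\<Prod>X\<in>UNIV. cos (\<delta> X)))"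
proof -
  define u v where "u = complex_of_real \<mu> *s tri (\<lambda>_. ket 0)"
    and "v = (complex_of_real \<nu> * w) *s tri (\<lambda>X. tilted_ket (\<delta> X))"
  have "inner u v = \<mu> * \<nu> * Re (w * complex_of_real (\<Prod>X\<in>UNIV. cos (\<delta> X)))"
    unfolding u_def v_def scale_tri[of _ _ Alice] inner_tri
    by (simp add: UNIV_party cinner_def algebra_simps)
  moreover have "norm u = \<bar>\<mu>\<bar>" "norm v = \<bar>\<nu>\<bar>"
    by (simp_all add: u_def v_def norm_smult norm_tri norm_mult assms)
  then have "inner u u = \<mu>\<^sup>2" "inner v v = \<nu>\<^sup>2"
    by (metis power2_abs power2_norm_eq_inner)+
  ultimately show ?thesis
    unfolding canonical_sum_def u_def[symmetric] v_def[symmetric] power2_norm_eq_inner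
    by (simp add: inner_add_left inner_add_right inner_commute)
qed

text \<open>The reflection in the line at angle \<delta>/2, which exchanges \<open>ket 0\<close> and
  \<open>tilted_ket \<delta>\<close>.\<close>

definition swap_op :: "real \<Rightarrow> qubit_op" where
  "swap_op \<delta> = mat2 (cos \<delta>) (sin \<delta>) (sin \<delta>) (- cos \<delta>)"

lemma unitary_swap_op: "unitary_op (swap_op \<delta>)"
  unfolding swap_op_def
  by (rule unitary_mat2) (simp_all add: add.commute flip: of_real_mult of_real_add)

lemma swap_op_apply:
  "swap_op \<delta> *v ket 0 = tilted_ket \<delta>" "swap_op \<delta> *v tilted_ket \<delta> = ket 0"
  using sin_cos_squared_add3[of \<delta>]
  by (simp_all add: swap_op_def vec_eq_iff all_2 add.commute flip: of_real_mult of_real_add)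

lemma canonical_sum_LU_swap:
  "LU_equivalent (canonical_sum \<mu> \<nu> w \<delta>)
    (complex_of_real \<mu> *s tri (\<lambda>X. tilted_ket (\<delta> X)) + (complex_of_real \<nu> * w) *s tri (\<lambda>_. ket 0))"
  by (rule LU_equivalentI[of "\<lambda>X. swap_op (\<delta> X)"])
    (simp_all add: unitary_swap_op canonical_sum_def matrix_vector_right_distrib mult_scale
      local_op_tri swap_op_apply)

lemma on_party_LU: "unitary_op U \<Longrightarrow> LU_equivalent \<psi> (on_party X U *v \<psi>)"
  unfolding on_party_eq by (rule LU_equivalentI[OF _ refl]) simp

lemma unitary_diag: "cmod z = 1 \<Longrightarrow> cmod w = 1 \<Longrightarrow> unitary_op (mat2 z 0 0 w)"
  by (rule unitary_mat2) (simp_all add: mult.commute flip: complex_norm_square)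

text \<open>Since the target has orthogonal factors at \<open>X\<close>, a diagonal measurement
  there sets the weights to (\<mu>, \<nu>) or (\<nu>, \<mu>). Exchanging the product vectors
  identifies the two results.\<close>

lemma LOCC_transforms_GHZ_orthogonal:
  assumes X: "tilted_ket (\<delta> X) = ket 1" and norm: "\<mu>\<^sup>2 + \<nu>\<^sup>2 = 1"
    and LU: "LU_equivalent \<xi> (canonical_sum \<mu> \<nu> (cis \<gamma>) \<delta>)"
  shows "LOCC_transforms GHZ \<xi>"
proof (rule LOCC_transforms_GHZ[of \<delta> X \<gamma>], rule LOCC_transforms_measure)
  have ket0: "tri ((\<lambda>_. ket 0)(X := z *s ket 0)) = z *s tri (\<lambda>_. ket 0)" for z
    by (simp add: scale_tri[of _ _ X])
  have phi: "tri ((\<lambda>X. tilted_ket (\<delta> X))(X := z *s ket 1)) = z *s tri (\<lambda>X. tilted_ket (\<delta> X))" for z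
    by (simp add: scale_tri[of _ _ X] X)
  have measured: "on_party X (mat2 a 0 0 b) *v pair_state ((\<lambda>X. tilted_ket (\<delta> X))(X := cis \<gamma> *s ket 1))
      = (1 / sqrt 2) *\<^sub>R canonical_sum a b (cis \<gamma>) \<delta>" for a b :: real
    by (simp add: pair_state_def canonical_sum_def scaleR_eq_smult mult_scale
        matrix_vector_right_distrib on_party_tri X ket0 phi)
  show "on_party X (mat2 \<mu> 0 0 \<nu>) *v pair_state ((\<lambda>X. tilted_ket (\<delta> X))(X := cis \<gamma> *s ket 1))
      = (1 / sqrt 2) *\<^sub>R canonical_sum \<mu> \<nu> (cis \<gamma>) \<delta>"
    and "on_party X (mat2 \<nu> 0 0 \<mu>) *v pair_state ((\<lambda>X. tilted_ket (\<delta> X))(X := cis \<gamma> *s ket 1))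
      = (1 / sqrt 2) *\<^sub>R canonical_sum \<nu> \<mu> (cis \<gamma>) \<delta>"
    by (rule measured)+
  show "dagger (mat2 \<mu> 0 0 \<nu>) ** mat2 \<mu> 0 0 \<nu> + dagger (mat2 \<nu> 0 0 \<mu>) ** mat2 \<nu> 0 0 \<mu> = mat 1"
    using norm by (simp add: dagger_mult_mat2 mat2_add mat2_one power2_eq_square add.commute
        flip: of_real_mult of_real_add)
  have "cos (\<delta> X) = 0"
    using arg_cong[OF X, of "\<lambda>v. v $ 0"] by simp
  then have cos: "(\<Prod>X\<in>UNIV. cos (\<delta> X)) = 0"
    by (cases X) (simp_all add: UNIV_party)
  have "(norm (canonical_sum \<mu> \<nu> (cis \<gamma>) \<delta>))\<^sup>2 = 1" "(norm (canonical_sum \<nu> \<mu> (cis \<gamma>) \<delta>))\<^sup>2 = 1"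
    using norm by (simp_all only: norm_canonical_sum[of "cis \<gamma>", OF norm_cis] cos) simp_all
  then show "norm (canonical_sum \<mu> \<nu> (cis \<gamma>) \<delta>) = 1" "norm (canonical_sum \<nu> \<mu> (cis \<gamma>) \<delta>) = 1"
    by (metis norm_ge_zero real_sqrt_one real_sqrt_unique)+
  show "LOCC_transforms (canonical_sum \<mu> \<nu> (cis \<gamma>) \<delta>) \<xi>"
    using LU by (rule LOCC_transforms_LU)
  \<comment> \<open>After the exchange the phase sits on the wrong term; this unitary removes it
    there and puts it on the tilted term.\<close>
  have "on_party X (mat2 (cis (- \<gamma>)) 0 0 (cis \<gamma>)) *v (complex_of_real \<mu> *s tri (\<lambda>X. tilted_ket (\<delta> X))
      + (complex_of_real \<nu> * cis \<gamma>) *s tri (\<lambda>_. ket 0)) = canonical_sum \<nu> \<mu> (cis \<gamma>) \<delta>"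
    by (simp add: matrix_vector_right_distrib mult_scale on_party_tri X ket0 phi
        canonical_sum_def add.commute mult.assoc cis_mult)
  moreover have "LU_equivalent (canonical_sum \<mu> \<nu> (cis \<gamma>) \<delta>)
      (on_party X (mat2 (cis (- \<gamma>)) 0 0 (cis \<gamma>)) *v (complex_of_real \<mu> *s tri (\<lambda>X. tilted_ket (\<delta> X))
        + (complex_of_real \<nu> * cis \<gamma>) *s tri (\<lambda>_. ket 0)))"
    by (rule LU_equivalent_trans[OF canonical_sum_LU_swap on_party_LU]) (simp add: unitary_diag)
  ultimately have "LU_equivalent (canonical_sum \<mu> \<nu> (cis \<gamma>) \<delta>) (canonical_sum \<nu> \<mu> (cis \<gamma>) \<delta>)"
    by (simp only:)
  then show "LOCC_transforms (canonical_sum \<nu> \<mu> (cis \<gamma>) \<delta>) \<xi>"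
    by (rule LOCC_transforms_LU[OF LU_equivalent_trans[OF LU]])
qed

text \<open>Alice tilts last, with outcomes of phase \<open>cis \<gamma>\<close> and
  \<open>- cis \<gamma>\<close>. Exchanging the terms inverts the relative phase, and for
  \<open>cos \<gamma> = 0\<close> inversion is the same as a change of sign.\<close>

lemma LOCC_transforms_GHZ_equal_norms:
  assumes cos: "cos \<gamma> = 0" and \<mu>: "\<mu> > 0" and norm: "norm (canonical_sum \<mu> \<mu> (cis \<gamma>) \<delta>) = 1"
    and LU: "LU_equivalent \<xi> (canonical_sum \<mu> \<mu> (cis \<gamma>) \<delta>)"
  shows "LOCC_transforms GHZ \<xi>"
proof (rule LOCC_transforms_GHZ[of \<delta> Alice \<gamma>],
    rule LOCC_transforms_measure[OF tilt_op_complete[of "\<delta> Alice"]])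
  \<comment> \<open>With \<open>cos \<gamma> = 0\<close> the cross term drops out of the norm, so
    the weights are already those of \<open>pair_state\<close>.\<close>
  have "2 * \<mu>\<^sup>2 = 1"
    using norm_canonical_sum[OF norm_cis, of \<mu> \<mu> \<gamma> \<delta>] norm cos by (simp del: of_real_prod)
  then have "\<mu> = sqrt (1 / 2)"
    using \<mu> by (intro real_sqrt_unique[symmetric]) auto
  then have \<mu>_eq: "\<mu> = 1 / sqrt 2"
    by (simp add: real_sqrt_divide)
  have "on_party Alice (tilt_op e (\<delta> Alice)) *v
      pair_state ((\<lambda>X. tilted_ket (\<delta> X))(Alice := cis \<gamma> *s ket 1))
      = (1 / sqrt 2) *\<^sub>R canonical_sum \<mu> \<mu> (complex_of_real e * cis \<gamma>) \<delta>" for e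
    by (subst tilt_op_pair_state[of _ Alice "cis \<gamma>"])
      (simp_all add: \<mu>_eq pair_state_def canonical_sum_def scaleR_eq_smult vec_eq_iff algebra_simps)
  from this[of 1] this[of "-1"]
  show "on_party Alice (tilt_op 1 (\<delta> Alice)) *v
      pair_state ((\<lambda>X. tilted_ket (\<delta> X))(Alice := cis \<gamma> *s ket 1))
      = (1 / sqrt 2) *\<^sub>R canonical_sum \<mu> \<mu> (cis \<gamma>) \<delta>"
    and "on_party Alice (tilt_op (-1) (\<delta> Alice)) *v
      pair_state ((\<lambda>X. tilted_ket (\<delta> X))(Alice := cis \<gamma> *s ket 1))
      = (1 / sqrt 2) *\<^sub>R canonical_sum \<mu> \<mu> (- cis \<gamma>) \<delta>"
    by simp_all
  have sq: "cis \<gamma> * cis \<gamma> = -1"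
    using sin_cos_squared_add[of \<gamma>] cos
    by (simp add: complex_eq_iff power2_eq_square)
  \<comment> \<open>A global phase makes the coefficient of the untilted term real again, because
    \<open>cis \<gamma>\<close> squares to -1.\<close>
  have "on_party Alice (mat2 (- cis \<gamma>) 0 0 (- cis \<gamma>)) *v (complex_of_real \<mu> *s tri (\<lambda>X. tilted_ket (\<delta> X))
      + (complex_of_real \<mu> * cis \<gamma>) *s tri (\<lambda>_. ket 0)) = canonical_sum \<mu> \<mu> (- cis \<gamma>) \<delta>"
  proof -
    have scalar: "mat2 z 0 0 z *v v = z *s v" for z v
      by (simp add: vec_eq_iff all_2)
    have "complex_of_real \<mu> * cis \<gamma> * - cis \<gamma> = \<mu>"
      using sq by (simp add: mult.assoc)
    moreover have "tri ((\<lambda>_. ket 0)(Alice := z *s ket 0)) = z *s tri (\<lambda>_. ket 0)"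
      "tri ((\<lambda>X. tilted_ket (\<delta> X))(Alice := z *s tilted_ket (\<delta> Alice))) = z *s tri (\<lambda>X. tilted_ket (\<delta> X))" for z
      by (simp_all add: scale_tri[of _ _ Alice])
    ultimately show ?thesis
      by (simp only: matrix_vector_right_distrib mult_scale on_party_tri scalar canonical_sum_def
          vector_smult_assoc add.commute)
  qed
  moreover have "LU_equivalent (canonical_sum \<mu> \<mu> (cis \<gamma>) \<delta>)
      (on_party Alice (mat2 (- cis \<gamma>) 0 0 (- cis \<gamma>)) *v (complex_of_real \<mu> *s tri (\<lambda>X. tilted_ket (\<delta> X))
        + (complex_of_real \<mu> * cis \<gamma>) *s tri (\<lambda>_. ket 0)))"
    by (rule LU_equivalent_trans[OF canonical_sum_LU_swap on_party_LU]) (simp add: unitary_diag)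
  ultimately have LU': "LU_equivalent (canonical_sum \<mu> \<mu> (cis \<gamma>) \<delta>) (canonical_sum \<mu> \<mu> (- cis \<gamma>) \<delta>)"
    by (simp only:)
  show "norm (canonical_sum \<mu> \<mu> (- cis \<gamma>) \<delta>) = 1"
    using norm LU_equivalent_norm[OF LU'] by simp
  show "LOCC_transforms (canonical_sum \<mu> \<mu> (cis \<gamma>) \<delta>) \<xi>"
    "LOCC_transforms (canonical_sum \<mu> \<mu> (- cis \<gamma>) \<delta>) \<xi>"
    using LOCC_transforms_LU[OF LU] LOCC_transforms_LU[OF LU_equivalent_trans[OF LU LU']] by simp_all
qed (fact norm)

theorem mainTheorem4:
  fixes \<xi> :: three_qubits
  assumes "norm \<xi> = 1"
    and "in_GHZ_class \<xi>"
    and "real_state \<xi>"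
  shows "LOCC_transforms GHZ \<xi> \<longleftrightarrow> Re (Omega \<xi>) = 0"
proof -
  obtain \<mu> \<nu> \<gamma> \<delta> where \<nu>: "\<nu> > 0" "\<mu> \<ge> \<nu>" and \<delta>: "\<And>X. \<delta> X \<in> {0<..pi / 2}"
    and LU: "LU_equivalent \<xi> (canonical_sum \<mu> \<nu> (cis \<gamma>) \<delta>)"
    and Omega: "Omega \<xi> = complex_of_real (\<mu> * \<nu>) * cis \<gamma> * (\<Prod>X\<in>UNIV. cos (\<delta> X))"
    using in_GHZ_class_Omega[OF assms(2)] unfolding is_Omega_iff by blast
  have \<mu>: "\<mu> > 0"
    using \<nu> by simp
  have norm: "norm (canonical_sum \<mu> \<nu> (cis \<gamma>) \<delta>) = 1"
    using LU_equivalent_norm[OF LU] assms(1) by simp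
  show ?thesis
  proof
    assume "LOCC_transforms GHZ \<xi>"
    then obtain p where p: "valid_protocol p" "\<And>\<phi>. can_end p GHZ \<phi> \<Longrightarrow> LU_equivalent \<xi> \<phi>"
      unfolding LOCC_transforms_def by blast
    obtain f g where fg: "GHZ = tri f + tri g" "inner (tri f) (tri g) = 0"
      using GHZ_decomposition by blast
    obtain f0 g0 where fg0: "canonical_sum \<mu> \<nu> (cis \<gamma>) \<delta> = tri f0 + tri g0"
      and nz: "\<And>X. det2 (f0 X) (g0 X) \<noteq> 0"
      and inner: "\<And>z. inner (z *s tri f0) (tri g0)
        = Re (cnj z * complex_of_real (\<mu> * \<nu>) * cis \<gamma> * (\<Prod>X\<in>UNIV. cos (\<delta> X)))"
      using canonical_sum_decomposition[of \<mu> \<nu> \<delta> \<gamma>] \<mu> \<nu>(1) \<delta> by metis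
    have "norm (tri f + tri g) = 1"
      unfolding fg(1)[symmetric] GHZ_eq_pair_state by (rule norm_pair_state[of _ Alice 1]) simp_all
    moreover have "LU_equivalent (tri f0 + tri g0) \<phi>" if "can_end p (tri f + tri g) \<phi>" for \<phi>
      \<comment> \<open>The canonical form replaces \<xi> as representative of the target orbit,
        since its two product terms are explicit.\<close>
      using LU_equivalent_trans[OF LU_equivalent_sym[OF LU] p(2)] that by (simp add: fg(1) flip: fg0)
    ultimately have "inner (tri f0) (tri g0) = 0"
      using deterministic_protocol_inner[OF p(1), of f g f0 g0] nz fg(2) by simp
    then show "Re (Omega \<xi>) = 0"
      using inner[of 1] by (simp add: Omega del: of_real_prod)
  next
    assume Re: "Re (Omega \<xi>) = 0"
    consider X where "cos (\<delta> X) = 0" | "\<mu> = \<nu>" "cos \<gamma> = 0"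
      using real_state_canonical_params[OF assms(3) LU \<mu> \<nu>(1) \<delta> Re[unfolded Omega]] by blast
    then show "LOCC_transforms GHZ \<xi>"
    proof cases
      case 1
      have "\<delta> X = pi / 2"
        using \<delta>[of X] 1 cos_gt_zero[of "\<delta> X"] by (cases "\<delta> X < pi / 2") auto
      have X: "tilted_ket (\<delta> X) = ket 1"
        unfolding \<open>\<delta> X = pi / 2\<close> by (simp add: vec_eq_iff all_2)
      have "(\<Prod>X\<in>UNIV. cos (\<delta> X)) = 0"
        using 1 by (cases X) (simp_all add: UNIV_party)
      \<comment> \<open>A vanishing cosine removes the cross term from the norm; the resulting
        identity is the completeness relation of the final measurement.\<close>
      then have "\<mu>\<^sup>2 + \<nu>\<^sup>2 = 1"
        using norm_canonical_sum[OF norm_cis, of \<mu> \<nu> \<gamma> \<delta>] norm by (simp del: of_real_prod)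
      then show ?thesis
        by (rule LOCC_transforms_GHZ_orthogonal[OF X _ LU])
    next
      case 2
      then show ?thesis
        using LOCC_transforms_GHZ_equal_norms[of \<gamma> \<mu> \<delta> \<xi>] \<mu> norm LU by simp
    qed
  qed
qed

end
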